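(* Let $n$ and $c$ be positive integers with $c \not\equiv 0, 2, 3 \pmod{n}$. Then the circulant digraph $\mathrm{Circ}(n; 2, 3, c)$ is not hamiltonian if and only if all of the following hold: (1) $n$ is a multiple of $6$, so that $n = 6m$ for some positive integer $m$; (2) with this $m$, either $c \equiv 3m+2 \pmod{n}$ or $c \equiv 3m+3 \pmod{n}$; and (3) $c$ is even.
   Context: For a finite set $S \subset \mathbb{Z}$ and a positive integer $n$, the circulant digraph $\mathrm{Circ}(n; S)$ has vertex set $\mathbb{Z}_n = \mathbb{Z}/n\mathbb{Z}$ and an arc from $v$ to $v+s$ for each $v \in \mathbb{Z}_n$ and $s \in S$. A digraph is hamiltonian if it has a hamiltonian cycle, i.e. a directed cycle passing through every vertex exactly once. *)

theory Defs
  imports "HOL-Number_Theory.Cong" "Graph_Theory.Graph_Theory"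
begin

(* The vertex set Z/nZ is represented by the canonical residues 0, ..., n - 1 in int.
   Arcs are pairs, so elements of S that are congruent modulo n give the same arc. *)
definition circ :: "nat \<Rightarrow> int set \<Rightarrow> int pair_pre_digraph" where
  "circ n S = \<lparr> pverts = {0..<int n},
                parcs = {(v, (v + s) mod int n) |v s. v \<in> {0..<int n} \<and> s \<in> S} \<rparr>"

(* In Graph_Theory, cycle already demands that no vertex is visited twice (and that the
   walk is non-empty and closed), so it remains to say that every vertex is visited. *)
definition hamiltonian_cycle :: "('a, 'b) pre_digraph \<Rightarrow> 'b list \<Rightarrow> bool" where
  "hamiltonian_cycle G p \<longleftrightarrow> pre_digraph.cycle G p \<and> tail G ` set p = verts G"

definition hamiltonian :: "('a, 'b) pre_digraph \<Rightarrow> bool" where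
  "hamiltonian G \<longleftrightarrow> (\<exists>p. hamiltonian_cycle G p)"

lemma fin_digraph_circ:
  assumes "n > 0" and "finite S"
  shows "fin_digraph (with_proj (circ n S))"
proof -
  have "parcs (circ n S) = (\<lambda>(v, s). (v, (v + s) mod int n)) ` ({0..<int n} \<times> S)"
    by (auto simp: circ_def)
  then have "finite (parcs (circ n S))"
    using assms(2) by simp
  then show ?thesis
    using assms(1) by unfold_locales (auto simp: circ_def)
qed

end

theory Submission
  imports Defs "HOL-Combinatorics.Cycles" "HOL-Combinatorics.Orbits"
begin

text \<open>
  Write \<open>d = c - 3\<close> and regard a choice of one outgoing arc at every vertex as a map on the integers that
  commutes with the translation by \<open>n\<close>.  If \<open>x\<close> leaves by an arc of length 2, then \<open>x - 1\<close> cannot leave by one of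
  length 3, since both would enter \<open>x + 2\<close>.  Hence the choices that are permutations and use \<open>c\<close> have a rigid shape: the
  vertices \<open>u i\<close> that leave by \<open>c\<close> cut the integers into blocks, and in each block the vertices use 2 up to some
  point \<open>t i\<close> and use 3 afterwards.  Exactly the vertices \<open>t i + 3\<close> are then not entered by an arc of length 2
  or 3, so the set of all \<open>t i\<close> is the set of all \<open>u i\<close> shifted by \<open>d\<close>.  Conversely, every periodic set of
  integers that interlaces with its shift by \<open>d\<close> gives such a permutation.  It is a hamiltonian cycle if and only
  if every colouring of the integers that is constant along its arcs and has period \<open>n\<close> is constant.  Only parity
  and residues modulo 3 matter when a colouring is carried through a block, which makes this easy to check.

  If \<open>n\<close> is odd or prime to 3, all arcs can have the same length.  Otherwise let \<open>n = 6m\<close> and let \<open>0 < d < n\<close>.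
  The gaps \<open>u (i + 1) - u i\<close> are chosen as follows.
  \<^item> \<open>d\<close> even and prime to 3: there is one block (\<open>hamiltonian_one_jump\<close>).
  \<^item> \<open>d\<close> odd and at most \<open>3m - 2\<close>: there are two blocks, of lengths \<open>3m + 1\<close> and \<open>3m - 1\<close>
    (\<open>hamiltonian_two_jumps\<close>).
  \<^item> \<open>d\<close> odd and greater than \<open>3m\<close>, or \<open>d > 3m\<close> divisible by 6: in terms of \<open>e = n - d\<close>, every second gap is
    \<open>e - 1\<close>, and the other gaps avoid certain residues modulo 6.  Each such pair of gaps already forces all the
    colours near it to agree (\<open>hamiltonian_backward_jump\<close>).
  \<^item> \<open>d \<le> 3m\<close> divisible by 6: all gaps are \<open>d\<close>, except for three or five shorter ones
    (\<open>hamiltonian_forward_jump\<close>).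

  What remains is \<open>d\<close> odd and equal to \<open>3m - 1\<close> or \<open>3m\<close>, the exceptional case of the theorem.  There \<open>c\<close>
  differs from 2 or from 3 by \<open>n / 2\<close>.  In a hamiltonian cycle the remaining one of the lengths 2 and 3 would be
  used by all vertices, by none, or by exactly one of any two opposite vertices.  The first two cases preserve
  divisibility by 2 or by 3.  In the third case the cycle is a translation composed with a cycle of length \<open>n / 2\<close>,
  and this has the wrong sign (\<open>not_hamiltonian_half_shift\<close>).
\<close>

section \<open>Hamiltonian cycles and permutations of the residues\<close>

lemma pcas_rotation:
  assumes "pcas u p v"
  shows "u # map snd p = map fst p @ [v]"
  using assms by (induction p arbitrary: u) auto

lemma pcas_of_vertex_sequence:
  "a \<le> b \<Longrightarrow> pcas (g a) (map (\<lambda>i. (g i, g (Suc i))) [a..<b]) (g b)"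
proof (induction "b - a" arbitrary: a)
  case 0
  then show ?case by simp
next
  case (Suc k)
  then have "a < b" by simp
  then have "[a..<b] = a # [Suc a..<b]" by (simp add: upt_conv_Cons)
  moreover have "pcas (g (Suc a)) (map (\<lambda>i. (g i, g (Suc i))) [Suc a..<b]) (g b)"
    using Suc \<open>a < b\<close> by auto
  ultimately show ?case by simp
qed

text \<open>
  This turns the arc list of a cycle into the cyclic list of its vertices, the form in which both directions of the
  theorem handle hamiltonian cycles.
\<close>

lemma hamiltonian_circ_iff:
  assumes "n > 0"
  shows "hamiltonian (with_proj (circ n S)) \<longleftrightarrow>
    (\<exists>vs. distinct vs \<and> set vs = {0..<int n} \<and>
      (\<forall>i<n. \<exists>s\<in>S. vs ! (Suc i mod n) = (vs ! i + s) mod int n))"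
    (is "_ \<longleftrightarrow> (\<exists>vs. ?enum vs)")
proof
  let ?G = "with_proj (circ n S)"
  assume "hamiltonian ?G"
  then obtain p where cyc: "pre_digraph.cycle ?G p" and cover: "fst ` set p = {0..<int n}"
    by (auto simp: hamiltonian_def hamiltonian_cycle_def circ_def)
  from cyc obtain u where walk: "pre_digraph.awalk ?G u p u"
    and dist: "distinct (tl (pre_digraph.awalk_verts ?G u p))" and ne: "p \<noteq> []"
    by (auto simp: pre_digraph.cycle_def)
  have cas: "pcas u p u" and arcs: "set p \<subseteq> parcs (circ n S)"
    using walk by (auto simp: pre_digraph.awalk_def cas_with_proj_eq)
  have rot: "u # map snd p = map fst p @ [u]"
    using pcas_rotation[OF cas] .
  have "distinct (map snd p)"
    using dist ne cas by (simp add: pre_digraph.awalk_verts_conv' cas_with_proj_eq)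
  moreover have "mset (map snd p) = mset (map fst p)"
    using arg_cong[OF rot, of mset] by simp
  ultimately have dist_fst: "distinct (map fst p)"
    by (metis mset_eq_imp_distinct_iff)
  have set_fst: "set (map fst p) = {0..<int n}"
    using cover by simp
  have len: "length p = n"
    using distinct_card[OF dist_fst] set_fst by simp
  have "\<exists>s\<in>S. map fst p ! (Suc i mod n) = (map fst p ! i + s) mod int n" if "i < n" for i
  proof -
    have "p ! i \<in> parcs (circ n S)"
      using arcs that len nth_mem by blast
    then obtain s where s: "s \<in> S" "snd (p ! i) = (fst (p ! i) + s) mod int n"
      by (auto simp: circ_def)
    have "snd (p ! i) = (u # map snd p) ! Suc i"
      using that len by simp
    also have "\<dots> = (map fst p @ [u]) ! Suc i"
      using rot by simp
    also have "\<dots> = map fst p ! (Suc i mod n)"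
    proof (cases "Suc i = n")
      case True
      have "u = (map fst p @ [u]) ! 0"
        using arg_cong[OF rot, of "\<lambda>xs. xs ! 0"] by simp
      then show ?thesis
        using True len ne by (simp add: nth_append)
    next
      case False
      then show ?thesis using that len by (simp add: nth_append)
    qed
    finally show ?thesis
      using s that len by (intro bexI[of _ s]) auto
  qed
  with dist_fst set_fst show "\<exists>vs. ?enum vs" by blast
next
  let ?G = "with_proj (circ n S)"
  assume "\<exists>vs. ?enum vs"
  then obtain vs where dist: "distinct vs" and set: "set vs = {0..<int n}"
    and step: "\<And>i. i < n \<Longrightarrow> \<exists>s\<in>S. vs ! (Suc i mod n) = (vs ! i + s) mod int n"
    by blast
  have len: "length vs = n"
    using distinct_card[OF dist] set by simp
  define g where "g i = vs ! (i mod n)" for i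
  define p where "p = map (\<lambda>i. (g i, g (Suc i))) [0..<n]"
  have fst_p: "map fst p = vs"
    by (rule nth_equalityI) (auto simp: p_def g_def len)
  have gn: "g n = g 0" by (simp add: g_def)
  have cas: "pcas (g 0) p (g 0)"
    using pcas_of_vertex_sequence[of 0 n g] by (simp add: p_def gn)
  have ne: "p \<noteq> []" using assms by (simp add: p_def)
  have gV: "g i \<in> {0..<int n}" for i
    using set len assms nth_mem[of "i mod n" vs] by (simp add: g_def)
  have "mset (map snd p) = mset vs"
    using arg_cong[OF pcas_rotation[OF cas], of mset] fst_p by simp
  then have "distinct (map snd p)"
    using dist mset_eq_imp_distinct_iff by blast
  then have "distinct (tl (pre_digraph.awalk_verts ?G (g 0) p))"
    using ne cas by (simp add: pre_digraph.awalk_verts_conv' cas_with_proj_eq)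
  moreover have "set p \<subseteq> parcs (circ n S)"
  proof
    fix e assume "e \<in> set p"
    then obtain i where i: "i < n" "e = (g i, g (Suc i))" by (auto simp: p_def)
    then show "e \<in> parcs (circ n S)"
      using step[OF i(1)] gV[of i] by (auto simp: circ_def g_def)
  qed
  then have "pre_digraph.awalk ?G (g 0) p (g 0)"
    using cas gV[of 0] by (simp add: pre_digraph.awalk_def cas_with_proj_eq circ_def)
  ultimately have "pre_digraph.cycle ?G p"
    using ne by (auto simp: pre_digraph.cycle_def)
  moreover have "fst ` set p = {0..<int n}"
    using fst_p set by (metis set_map)
  ultimately show "hamiltonian ?G"
    by (auto simp: hamiltonian_def hamiltonian_cycle_def circ_def)
qed

text \<open>
  The last hypothesis says that the permutation induced modulo \<open>n\<close> is transitive.  It is applied to the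
  characteristic function of an orbit.  Stating transitivity through colourings allows arcs to be followed in both
  directions, so that no orbit has to be traced step by step.
\<close>

lemma hamiltonian_of_bijection:
  fixes f :: "int \<Rightarrow> int"
  assumes "n > 0" and inj: "inj f" and per: "\<And>x. f (x + int n) = f x + int n"
    and arc: "\<And>x. \<exists>s\<in>S. [f x = x + s] (mod int n)"
    and conn: "\<And>\<phi> :: int \<Rightarrow> bool. (\<And>x. \<phi> (x + int n) = \<phi> x) \<Longrightarrow> (\<And>x. \<phi> (f x) = \<phi> x) \<Longrightarrow>
      (\<And>x. \<phi> x = \<phi> 0)"
  shows "hamiltonian (with_proj (circ n S))"
proof -
  define V where "V = {0..<int n}"
  \<comment> \<open>the permutation of the residues induced by \<open>f\<close>, extended by the identity\<close>
  define h where "h x = (if x \<in> V then f x mod int n else x)" for x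
  have per_q: "f (x + q * int n) = f x + q * int n" for x q
  proof (induction q rule: int_induct[where k = 0])
    case (step1 i)
    then show ?case using per[of "x + i * int n"] by (simp add: algebra_simps)
  next
    case (step2 i)
    then show ?case using per[of "x + (i - 1) * int n"] by (simp add: algebra_simps)
  qed simp
  have f_mod: "f (x mod int n) mod int n = f x mod int n" for x
    using per_q[of "x mod int n" "x div int n"] by (metis mod_div_mult_eq mod_mult_self1)
  have h_mod: "h (x mod int n) = f x mod int n" for x
    using \<open>n > 0\<close> f_mod by (simp add: h_def V_def)
  have inj_h: "inj_on h V"
  proof (rule inj_onI)
    fix x y assume xy: "x \<in> V" "y \<in> V" "h x = h y"
    then have "f x mod int n = f y mod int n" by (simp add: h_def)
    then obtain q where "f x = f y + q * int n"
      by (metis mod_eqE mult.commute mod_eq_dvd_iff dvd_def diff_add_cancel add.commute)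
    then have "f x = f (y + q * int n)" by (simp add: per_q)
    then have "x = y + q * int n" using inj by (simp add: inj_eq)
    then have "x mod int n = y mod int n" by simp
    then show "x = y" using xy by (simp add: V_def)
  qed
  have h_V: "h x \<in> V" if "x \<in> V" for x
    using that \<open>n > 0\<close> by (simp add: h_def V_def)
  have "h ` V = V"
    using inj_h h_V by (intro endo_inj_surj) (auto simp: V_def)
  then have perm: "h permutes V"
    using inj_h by (intro bij_imp_permutes) (auto simp: bij_betw_def h_def)
  have 0: "0 \<in> V" using \<open>n > 0\<close> by (simp add: V_def)
  have fin: "finite V" by (simp add: V_def)
  have permh: "permutation h" using perm fin permutation_permutes by blast
  define \<phi> where "\<phi> x \<longleftrightarrow> x mod int n \<in> orbit h 0" for x
  have "\<phi> x = \<phi> 0" for x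
  proof (rule conn)
    show "\<phi> (x + int n) = \<phi> x" for x by (simp add: \<phi>_def)
    have "h y \<in> orbit h 0 \<longleftrightarrow> y \<in> orbit h 0" for y
    proof
      assume "h y \<in> orbit h 0"
      moreover have "y \<in> orbit h (h y)"
        using permutation_self_in_orbit[OF permh, of y] self_in_orbit_step[of y h] by simp
      ultimately show "y \<in> orbit h 0" by (rule orbit_trans[rotated])
    qed (rule orbit.step)
    then show "\<phi> (f x) = \<phi> x" for x
      unfolding \<phi>_def h_mod[symmetric] by blast
  qed
  moreover have "\<phi> 0" using permh by (simp add: \<phi>_def permutation_self_in_orbit)
  ultimately have "\<phi> x" for x by simp
  moreover have "x mod int n = x" if "x \<in> V" for x using that by (simp add: V_def)
  ultimately have "V \<subseteq> orbit h 0" unfolding \<phi>_def by (metis subsetI)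
  moreover have "orbit h 0 \<subseteq> V" using perm 0 permutes_orbit_subset by metis
  ultimately have orb: "orbit h 0 = V" by blast
  define N where "N = funpow_dist1 h 0 0"
  define vs where "vs = map (\<lambda>i. (h ^^ i) 0) [0..<N]"
  have self: "0 \<in> orbit h 0" using 0 orb by simp
  have "orbit h 0 = (\<lambda>i. (h ^^ i) 0) ` {0..<N}"
    unfolding N_def by (rule orbit_conv_funpow_dist1[OF self])
  then have set: "set vs = V" by (simp add: vs_def orb)
  have "inj_on (\<lambda>i. (h ^^ i) 0) {0..<N}"
    unfolding N_def by (rule inj_on_funpow_dist1[OF self])
  then have dist: "distinct vs" by (simp add: vs_def distinct_map)
  have "length vs = n" using distinct_card[OF dist] set by (simp add: V_def)
  then have N: "N = n" by (simp add: vs_def)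
  have "(h ^^ N) 0 = 0"
    unfolding N_def by (rule funpow_dist1_prop[OF self])
  then have hN: "(h ^^ n) 0 = 0" by (simp add: N)
  have "\<exists>s\<in>S. vs ! (Suc i mod n) = (vs ! i + s) mod int n" if "i < n" for i
  proof -
    have "vs ! (Suc i mod n) = (h ^^ (Suc i mod n)) 0"
      using that N by (simp add: vs_def)
    also have "\<dots> = h (vs ! i)"
      using that N hN by (cases "Suc i = n") (auto simp: vs_def)
    finally have "vs ! (Suc i mod n) = h (vs ! i)" .
    moreover have "vs ! i \<in> V" using that set N vs_def by (metis \<open>length vs = n\<close> nth_mem)
    ultimately have "vs ! (Suc i mod n) = f (vs ! i) mod int n" by (simp add: h_def)
    then show ?thesis using arc[of "vs ! i"] by (auto simp: cong_def)
  qed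
  then show ?thesis
    using dist set hamiltonian_circ_iff[OF \<open>n > 0\<close>] by (auto simp: V_def)
qed

lemma invariant_multiple:
  fixes \<phi> :: "int \<Rightarrow> 'a"
  assumes "\<And>x. \<phi> (x + a) = \<phi> x"
  shows "\<phi> (x + q * a) = \<phi> x"
proof (induction q rule: int_induct[where k = 0])
  case (step1 i)
  then show ?case using assms[of "x + i * a"] by (simp add: algebra_simps)
next
  case (step2 i)
  then show ?case using assms[of "x + (i - 1) * a"] by (simp add: algebra_simps)
qed simp

lemma hamiltonian_of_coprime_jump:
  assumes "n > 0" and "s \<in> S" and "coprime s (int n)"
  shows "hamiltonian (with_proj (circ n S))"
proof (rule hamiltonian_of_bijection[where f = "\<lambda>x. x + s"])
  fix \<phi> :: "int \<Rightarrow> bool" and x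
  assume per: "\<And>x. \<phi> (x + int n) = \<phi> x" and inv: "\<And>x. \<phi> (x + s) = \<phi> x"
  obtain a b where "a * s + b * int n = 1"
    using bezout_int[of s "int n"] assms(3) by auto
  then have "x = 0 + (x * a) * s + (x * b) * int n"
    by (metis add_0 distrib_left mult.assoc mult.right_neutral)
  then show "\<phi> x = \<phi> 0"
    using invariant_multiple[of \<phi>, OF per] invariant_multiple[of \<phi>, OF inv] by metis
qed (use assms in \<open>auto simp: inj_def intro!: bexI[of _ s]\<close>)

section \<open>Interlacing sets of jumps\<close>

text \<open>
  The \<open>u i\<close>, in increasing order, are the integers that leave by an arc of length \<open>d + 3\<close>, and \<open>k\<close> of them form a
  period.  From \<open>u i\<close> on, the arcs have length 2 up to \<open>t i\<close> and length 3 afterwards, so \<open>t i + 3\<close> is the one target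
  in the block that is left for a long arc.  That arc comes from \<open>u (i - r)\<close>, so \<open>r\<close> is the number of blocks by
  which a long arc advances; it is negative if \<open>d\<close> stands for a backward jump.
\<close>

locale interlacing =
  fixes n :: nat and k r d :: int and u t :: "int \<Rightarrow> int"
  assumes n_pos: "n > 0"
    and u_periodic: "u (i + k) = u i + int n"
    and t_eq: "t i = u (i - r) + d"
    and u_le_t: "u i \<le> t i"
    and t_less_u: "t i < u (i + 1)"
begin

lemma t_periodic: "t (i + k) = t i + int n"
  using u_periodic[of "i - r"] by (simp add: t_eq algebra_simps)

lemma u_step: "u i + 1 \<le> u (i + 1)"
  using u_le_t[of i] t_less_u[of i] by linarith

lemma u_growth: "0 \<le> m \<Longrightarrow> u i + m \<le> u (i + m)"
proof (induction m rule: int_ge_induct)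
  case (step m)
  then show ?case using u_step[of "i + m"] by (simp add: algebra_simps)
qed simp

lemma u_less: "i < j \<Longrightarrow> u i < u j"
  using u_growth[of "j - i" i] by simp

lemma ex_block: "\<exists>i. u i \<le> x \<and> x < u (i + 1)"
proof (rule ccontr)
  assume none: "\<not> ?thesis"
  define a where "a = - \<bar>x - u 0\<bar>"
  have "u a \<le> x" using u_growth[of "- a" a] by (simp add: a_def)
  have "u (a + m) \<le> x" if "0 \<le> m" for m
    using that
  proof (induction m rule: int_ge_induct)
    case (step m)
    then show ?case using none by (smt (verit, best))
  qed (use \<open>u a \<le> x\<close> in simp)
  from this[of "\<bar>x - u 0\<bar> + 1 - a"] have "u (\<bar>x - u 0\<bar> + 1) \<le> x"
    by (simp add: a_def)
  then show False using u_growth[of "\<bar>x - u 0\<bar> + 1" 0] by simp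
qed

definition block :: "int \<Rightarrow> int" where
  "block x = (THE i. u i \<le> x \<and> x < u (i + 1))"

lemma block_eqI:
  assumes "u i \<le> x" "x < u (i + 1)"
  shows "block x = i"
  unfolding block_def
proof (rule the_equality)
  fix j assume j: "u j \<le> x \<and> x < u (j + 1)"
  have "\<not> i < j" using assms j u_less[of "i + 1" j] by (cases "i + 1 = j") auto
  moreover have "\<not> j < i" using assms j u_less[of "j + 1" i] by (cases "j + 1 = i") auto
  ultimately show "j = i" by simp
qed (use assms in blast)

lemma block_bounds: "u (block x) \<le> x" "x < u (block x + 1)"
  using ex_block[of x] block_eqI by metis+

definition successor :: "int \<Rightarrow> int" where
  "successor x = (if x = u (block x) then x + d + 3
                  else if x \<le> t (block x) then x + 2 else x + 3)"

text \<open>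
  Shifted by 3, the blocks of sources are the blocks of targets: a target lies in the block of its source, except
  that the long arcs change the block by \<open>r\<close>.
\<close>

definition target_block :: "int \<Rightarrow> int" where
  "target_block x = (if x = u (block x) then block x + r else block x)"

lemma block_of_successor:
  "block (successor x - 3) = target_block x"
proof (rule block_eqI)
  show "u (target_block x) \<le> successor x - 3"
    using u_le_t[of "block x + r"] u_le_t[of "block x"] block_bounds[of x]
    by (auto simp: successor_def target_block_def t_eq)
  show "successor x - 3 < u (target_block x + 1)"
    using t_less_u[of "block x + r"] t_less_u[of "block x"] block_bounds[of x]
    by (auto simp: successor_def target_block_def t_eq)
qed

text \<open>
  By \<open>block_of_successor\<close> two sources of the same target agree on their target block \<open>j\<close>.  In it the arcs of length 2
  fill the targets from \<open>u j + 3\<close> to \<open>t j + 2\<close>, those of length 3 fill the targets from \<open>t j + 4\<close> to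
  \<open>u (j + 1) + 2\<close>, and the long arc supplies the missing target \<open>t j + 3\<close>.
\<close>

lemma inj_successor: "inj successor"
proof (rule injI)
  fix x y assume eq: "successor x = successor y"
  then have same: "target_block x = target_block y"
    using block_of_successor by metis
  have jump: "successor z = t (target_block z) + 3" if "z = u (block z)" for z
    using that by (simp add: successor_def target_block_def t_eq)
  show "x = y"
  proof (cases "x = u (block x)"; cases "y = u (block y)")
    assume "x = u (block x)" "y = u (block y)"
    then show ?thesis using same by (metis target_block_def add_right_cancel)
  next
    assume "x = u (block x)" "y \<noteq> u (block y)"
    then show ?thesis using jump[of x] eq same
      by (auto simp: successor_def target_block_def split: if_splits)
  next
    assume "x \<noteq> u (block x)" "y = u (block y)"
    then show ?thesis using jump[of y] eq same
      by (auto simp: successor_def target_block_def split: if_splits)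
  next
    assume "x \<noteq> u (block x)" "y \<noteq> u (block y)"
    then show ?thesis using eq same
      by (auto simp: successor_def target_block_def split: if_splits)
  qed
qed

lemma block_periodic: "block (x + int n) = block x + k"
proof (rule block_eqI)
  show "u (block x + k) \<le> x + int n"
    using block_bounds[of x] by (simp add: u_periodic)
  show "x + int n < u (block x + k + 1)"
    using block_bounds[of x] u_periodic[of "block x + 1"] by (simp add: algebra_simps)
qed

lemma successor_periodic: "successor (x + int n) = successor x + int n"
  by (simp add: successor_def block_periodic u_periodic t_periodic)

end

section \<open>Colourings that are constant along the arcs\<close>

locale interlacing_colouring = interlacing +
  fixes \<phi> :: "int \<Rightarrow> bool"
  assumes colour_periodic: "\<phi> (x + int n) = \<phi> x"
    and colour_jump: "\<phi> (t i + 3) = \<phi> (u (i - r))"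
    and colour_2: "u i < x \<Longrightarrow> x \<le> t i \<Longrightarrow> \<phi> (x + 2) = \<phi> x"
    and colour_3: "t i < x \<Longrightarrow> x < u (i + 1) \<Longrightarrow> \<phi> (x + 3) = \<phi> x"
begin

lemma colour_2s:
  assumes "u i < x" "0 \<le> m" "x + 2 * m \<le> t i + 2"
  shows "\<phi> (x + 2 * m) = \<phi> x"
  using assms(2,3)
proof (induction m rule: int_ge_induct)
  case (step m)
  then show ?case using colour_2[of i "x + 2 * m"] assms(1) by (simp add: algebra_simps)
qed simp

lemma colour_3s:
  assumes "t i < x" "0 \<le> m" "x + 3 * m \<le> u (i + 1) + 2"
  shows "\<phi> (x + 3 * m) = \<phi> x"
  using assms(2,3)
proof (induction m rule: int_ge_induct)
  case (step m)
  then show ?case using colour_3[of i "x + 3 * m"] assms(1) by (simp add: algebra_simps)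
qed simp

text \<open>
  The strand through \<open>u i\<close> leaves the block at once.  The two strands through \<open>u i + 1\<close> and \<open>u i + 2\<close> survive the
  arcs of length 2; they arrive just behind \<open>t i\<close> in the same order or swapped, depending on parity.
\<close>

lemma colour_after_2s_even:
  assumes "even (t i - u i)"
  shows "\<phi> (t i + 1) = \<phi> (u i + 1)" "\<phi> (t i + 2) = \<phi> (u i + 2)"
proof -
  obtain m where m: "t i = u i + 2 * m" using assms by (metis evenE diff_eq_eq add.commute)
  then have "0 \<le> m" using u_le_t[of i] by simp
  then show "\<phi> (t i + 1) = \<phi> (u i + 1)" "\<phi> (t i + 2) = \<phi> (u i + 2)"
    using colour_2s[of i "u i + 1" m] colour_2s[of i "u i + 2" m] m by (simp_all add: algebra_simps)
qed

lemma colour_after_2s_odd: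
  assumes "odd (t i - u i)"
  shows "\<phi> (t i + 1) = \<phi> (u i + 2)" "\<phi> (t i + 2) = \<phi> (u i + 1)"
proof -
  obtain m where m: "t i = u i + 2 * m + 1"
    using assms by (metis oddE diff_eq_eq add.commute add.left_commute)
  then have "0 \<le> m" using u_le_t[of i] by simp
  then show "\<phi> (t i + 1) = \<phi> (u i + 2)" "\<phi> (t i + 2) = \<phi> (u i + 1)"
    using colour_2s[of i "u i + 2" m] colour_2s[of i "u i + 1" "m + 1"] m
    by (simp_all add: algebra_simps)
qed

text \<open>
  Behind \<open>t i\<close> three strands run in parallel, one in each residue class modulo 3, until they reach the first three
  positions of the next block.
\<close>

lemma colour_after_3s:
  assumes "t i < x" "x \<le> t i + 3" "u (i + 1) \<le> y" "y \<le> u (i + 1) + 2" "3 dvd y - x"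
  shows "\<phi> y = \<phi> x"
proof -
  obtain m where m: "y = x + 3 * m"
    using assms(5) by (metis dvdE diff_eq_eq add.commute)
  then have "0 \<le> m" using assms t_less_u[of i] by simp
  then show ?thesis using colour_3s[of i x m] assms m by simp
qed

text \<open>
  Following its arcs, every integer reaches one of the first three positions of a block, so these positions decide
  whether a colouring is constant.
\<close>

lemma colour_constant:
  assumes "\<And>i q. q \<in> {0, 1, 2} \<Longrightarrow> \<phi> (u i + q) = c"
  shows "\<phi> x = c"
proof -
  define i where "i = block x"
  have right: "\<phi> y = c" if y: "t i < y" "y \<le> u (i + 1) + 2" for y
  proof -
    define m where "m = (u (i + 1) + 2 - y) div 3"
    define q where "q = y + 3 * m - u (i + 1)"
    have "0 \<le> m" using y by (simp add: m_def)
    moreover have "q \<in> {0, 1, 2}" unfolding q_def m_def by auto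
    ultimately show ?thesis
      using assms[of q "i + 1"] colour_3s[of i y m] y by (auto simp: q_def)
  qed
  show ?thesis
  proof (cases "x = u i \<or> t i < x")
    case True
    then show ?thesis
      using assms[of 0 i] right[of x] block_bounds[of x] by (auto simp: i_def)
  next
    case False
    then have x: "u i < x" "x \<le> t i" using block_bounds[of x] by (auto simp: i_def)
    define m where "m = (t i + 2 - x) div 2"
    have m: "0 \<le> m" "t i < x + 2 * m" "x + 2 * m \<le> t i + 2"
      using x by (simp_all add: m_def)
    then show ?thesis
      using colour_2s[of i x m] x right[of "x + 2 * m"] t_less_u[of i] by simp
  qed
qed

end

lemma (in interlacing_colouring) colour_window:
  assumes "k > 0" and "\<And>i q. 0 \<le> i \<Longrightarrow> i < k \<Longrightarrow> q \<in> {0, 1, 2} \<Longrightarrow> \<phi> (u i + q) = c"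
  shows "\<phi> x = c"
proof (rule colour_constant)
  fix i q :: int
  assume q: "q \<in> {0, 1, 2}"
  have "\<phi> (u (i + k) + q) = \<phi> (u i + q)" for i
    using colour_periodic[of "u i + q"] by (simp add: u_periodic algebra_simps)
  then have "\<phi> (u (i mod k + (i div k) * k) + q) = \<phi> (u (i mod k) + q)"
    by (rule invariant_multiple)
  then show "\<phi> (u i + q) = c"
    using assms(1) assms(2)[of "i mod k" q] q by (simp add: add.commute)
qed

text \<open>
  The criterion behind all constructions: interlacing makes \<open>successor\<close> injective, and colourings detect that it
  has only one orbit.
\<close>

theorem (in interlacing) hamiltonian_of_colouring:
  assumes "2 \<in> S" "3 \<in> S" "s \<in> S" "[d + 3 = s] (mod int n)"
    and conn: "\<And>\<phi>. interlacing_colouring n k r d u t \<phi> \<Longrightarrow> (\<And>x. \<phi> x = \<phi> 0)"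
  shows "hamiltonian (with_proj (circ n S))"
proof (rule hamiltonian_of_bijection[OF n_pos inj_successor successor_periodic])
  show "\<exists>s\<in>S. [successor x = x + s] (mod int n)" for x
  proof -
    have "[x + (d + 3) = x + s] (mod int n)"
      using assms(4) by (intro cong_add cong_refl)
    then have "[x + d + 3 = x + s] (mod int n)" by (simp add: add.assoc)
    then show ?thesis
      using assms(1-3) by (cases "x = u (block x)"; cases "x \<le> t (block x)")
        (auto simp only: successor_def if_True if_False simp_thms intro: bexI[of _ s] bexI[of _ 2] bexI[of _ 3] cong_refl)
  qed
next
  fix \<phi> :: "int \<Rightarrow> bool" and x
  assume per: "\<And>x. \<phi> (x + int n) = \<phi> x" and inv: "\<And>x. \<phi> (successor x) = \<phi> x"
  have "interlacing_colouring n k r d u t \<phi>"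
  proof
    show "\<phi> (x + int n) = \<phi> x" for x by (rule per)
    show "\<phi> (t i + 3) = \<phi> (u (i - r))" for i
    proof -
      have "block (u (i - r)) = i - r"
        using u_step[of "i - r"] by (intro block_eqI) auto
      then show ?thesis using inv[of "u (i - r)"] by (simp add: successor_def t_eq)
    qed
    show "\<phi> (x + 2) = \<phi> x" if "u i < x" "x \<le> t i" for i x
      using inv[of x] block_eqI[of i x] that t_less_u[of i] by (simp add: successor_def)
    show "\<phi> (x + 3) = \<phi> x" if "t i < x" "x < u (i + 1)" for i x
      using inv[of x] block_eqI[of i x] that u_le_t[of i] by (simp add: successor_def)
  qed
  then show "\<phi> x = \<phi> 0" by (rule conn)
qed

text \<open>
  Interlacing sets are built from their gaps, because the interlacing conditions only involve neighbouring gaps.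
\<close>

lemma ex_periodic_prefix_sums:
  fixes g :: "int \<Rightarrow> int"
  assumes "k > 0" "\<And>i. g (i + k) = g i" "(\<Sum>i\<in>{0..<k}. g i) = N"
  shows "\<exists>u. u 0 = 0 \<and> (\<forall>i. u (i + 1) = u i + g i) \<and> (\<forall>i. u (i + k) = u i + N)"
proof -
  have g_mod: "g (i mod k) = g i" for i
    using invariant_multiple[of g k "i mod k" "i div k"] assms(2) by simp
  define u where "u i = N * (i div k) + (\<Sum>l\<in>{0..<i mod k}. g l)" for i
  have "u (i + 1) = u i + g i" for i
  proof (cases "i mod k = k - 1")
    case True
    then have "i + 1 = k * (i div k + 1)" using mult_div_mod_eq[of k i]
      by (simp only: distrib_left mult_1_right)
    then have "(i + 1) div k = i div k + 1" "(i + 1) mod k = 0"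
      using assms(1) by (metis nonzero_mult_div_cancel_left less_irrefl, metis mod_mult_self1_is_0)
    moreover have "{0..<k} = insert (k - 1) {0..<k - 1}" using assms(1) by auto
    then have "N = g (k - 1) + (\<Sum>l\<in>{0..<k - 1}. g l)" using assms(3) by simp
    moreover have "g (k - 1) = g i" using g_mod[of i] True by simp
    ultimately show ?thesis unfolding u_def True by (simp add: distrib_left)
  next
    case False
    then have lt: "i mod k + 1 < k" using assms(1) pos_mod_bound[of k i] by linarith
    have ge: "0 \<le> i mod k" using assms(1) by simp
    have "i + 1 = (i mod k + 1) + k * (i div k)" by simp
    then have "(i + 1) div k = i div k" "(i + 1) mod k = i mod k + 1"
      using lt ge by (metis div_mult_self2 div_pos_pos_trivial add_0 less_irrefl assms(1) add_increasing2 zero_le_one add.commute,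
        metis mod_mult_self2 mod_pos_pos_trivial add_increasing2 zero_le_one add.commute)
    moreover have "{0..<i mod k + 1} = insert (i mod k) {0..<i mod k}" using ge by auto
    ultimately show ?thesis using g_mod[of i] by (simp add: u_def algebra_simps)
  qed
  moreover have "u (i + k) = u i + N" for i
    using assms(1) by (simp add: u_def algebra_simps)
  moreover have "u 0 = 0" by (simp add: u_def)
  ultimately show ?thesis by blast
qed

text \<open>
  For a given \<open>r\<close> the hypothesis \<open>fits\<close> compares \<open>d\<close> with sums of consecutive gaps, since \<open>t i - u i\<close> is \<open>d\<close> minus
  the distance from \<open>u (i - r)\<close> to \<open>u i\<close>.
\<close>

lemma hamiltonian_of_gaps:
  fixes g :: "int \<Rightarrow> int"
  assumes "n > 0" "k > 0" and per: "\<And>i. g (i + k) = g i" and sum: "(\<Sum>i\<in>{0..<k}. g i) = int n"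
    and c: "[d + 3 = c] (mod int n)"
    and fits: "\<And>u i. (\<And>i. u (i + 1) = u i + g i) \<Longrightarrow>
      u i \<le> u (i - r) + d \<and> u (i - r) + d < u (i + 1)"
    and conn: "\<And>u \<phi> x. u 0 = 0 \<Longrightarrow> (\<And>i. u (i + 1) = u i + g i) \<Longrightarrow>
      interlacing_colouring n k r d u (\<lambda>i. u (i - r) + d) \<phi> \<Longrightarrow> \<phi> x = \<phi> 0"
  shows "hamiltonian (with_proj (circ n {2, 3, c}))"
proof -
  obtain u where u: "u 0 = 0" "\<And>i. u (i + 1) = u i + g i" "\<And>i. u (i + k) = u i + int n"
    using ex_periodic_prefix_sums[OF assms(2) per sum] by blast
  interpret interlacing n k r d u "\<lambda>i. u (i - r) + d"
    using assms(1) u(3) fits[OF u(2)] by unfold_locales auto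
  show ?thesis
    by (rule hamiltonian_of_colouring[of _ c]) (use c conn[OF u(1,2)] in auto)
qed

section \<open>One or two jumps per turn\<close>

text \<open>
  With a single block the colours of 0, 1 and 2 are permuted by one turn around the circle.  This permutation is a
  3-cycle if \<open>d\<close> is even and prime to 3.
\<close>

lemma hamiltonian_one_jump:
  fixes d c :: int
  assumes "n > 0" "6 dvd n" "0 \<le> d" "d < int n" "even d" "\<not> 3 dvd d"
    and "[d + 3 = c] (mod int n)"
  shows "hamiltonian (with_proj (circ n {2, 3, c}))"
proof (rule hamiltonian_of_gaps[where k = 1 and r = 0 and d = d and g = "\<lambda>_. int n"])
  fix u :: "int \<Rightarrow> int" and \<phi> x
  assume u0: "u 0 = 0" and u: "\<And>i. u (i + 1) = u i + int n"
    and "interlacing_colouring n 1 0 d u (\<lambda>i. u (i - 0) + d) \<phi>"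
  then interpret interlacing_colouring n 1 0 d u "\<lambda>i. u (i - 0) + d" \<phi> by simp
  have u1: "u 1 = int n" using u[of 0] u0 by simp
  have n: "3 dvd int n" using assms(2) by presburger
  have per: "\<phi> (int n) = \<phi> 0" "\<phi> (int n + 1) = \<phi> 1" "\<phi> (int n + 2) = \<phi> 2"
    using colour_periodic[of 0] colour_periodic[of 1] colour_periodic[of 2]
    by (simp_all add: add.commute)
  have after_2s: "\<phi> (d + 1) = \<phi> 1" "\<phi> (d + 2) = \<phi> 2" "\<phi> (d + 3) = \<phi> 0"
    using colour_after_2s_even[of 0] colour_jump[of 0] assms(5) by (simp_all add: u0)
  have after_3s: "\<phi> y = \<phi> x" if "d < x" "x \<le> d + 3" "int n \<le> y" "y \<le> int n + 2" "3 dvd y - x" for x y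
    using colour_after_3s[of 0 x y] that by (simp add: u0 u1)
  have "d mod 3 = 1 \<or> d mod 3 = 2" using assms(6) by presburger
  then consider "d mod 3 = 1" | "d mod 3 = 2" by blast
  then have "\<phi> 1 = \<phi> 0 \<and> \<phi> 2 = \<phi> 0"
  proof cases
    case 1
    then have "3 dvd int n - (d + 2)" "3 dvd int n + 1 - (d + 3)" using n by presburger+
    then show ?thesis
      using after_3s[of "d + 2" "int n"] after_3s[of "d + 3" "int n + 1"] per after_2s by simp
  next
    case 2
    then have "3 dvd int n - (d + 1)" "3 dvd int n + 2 - (d + 3)" using n by presburger+
    then show ?thesis
      using after_3s[of "d + 1" "int n"] after_3s[of "d + 3" "int n + 2"] per after_2s by simp
  qed
  then have "\<phi> (u i + q) = \<phi> 0" if "0 \<le> i" "i < 1" "q \<in> {0, 1, 2}" for i q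
  proof -
    have "i = 0" using that by simp
    with u0 have "u i = 0" by simp
    then show ?thesis using that(3) \<open>\<phi> 1 = \<phi> 0 \<and> \<phi> 2 = \<phi> 0\<close> by (auto simp: u0)
  qed
  then show "\<phi> x = \<phi> 0" by (rule colour_window[rotated]) simp_all
qed (use assms in auto)

text \<open>
  As \<open>d\<close> is odd, each of the two blocks reverses the order of the three strands and then rotates them by the number
  of its arcs of length 3.  The two reflections compose to a rotation by the difference of these numbers, which is
  \<open>(3m + 1) - (3m - 1) = 2\<close>, and this is prime to 3.
\<close>

lemma hamiltonian_two_jumps:
  fixes d c :: int
  assumes "m > 0" "0 \<le> d" "d \<le> 3 * int m - 2" "odd d"
    and "[d + 3 = c] (mod int (6 * m))"
  shows "hamiltonian (with_proj (circ (6 * m) {2, 3, c}))"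
proof (rule hamiltonian_of_gaps[where k = 2 and r = 0 and d = d and
      g = "\<lambda>i. if even i then 3 * int m + 1 else 3 * int m - 1"])
  have "{0..<2} = {0, 1 :: int}" by auto
  then show "(\<Sum>i\<in>{0..<2::int}. if even i then 3 * int m + 1 else 3 * int m - 1) = int (6 * m)"
    by simp
next
  fix u :: "int \<Rightarrow> int" and \<phi> x
  assume u0: "u 0 = 0" and u: "\<And>i. u (i + 1) = u i + (if even i then 3 * int m + 1 else 3 * int m - 1)"
    and "interlacing_colouring (6 * m) 2 0 d u (\<lambda>i. u (i - 0) + d) \<phi>"
  then interpret interlacing_colouring "6 * m" 2 0 d u "\<lambda>i. u (i - 0) + d" \<phi> by simp
  define M where "M = int m"
  have u1: "u 1 = 3 * M + 1" using u[of 0] u0 by (simp add: M_def)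
  have u2: "u 2 = 6 * M" using u[of 1] u1 by (simp add: M_def)
  have per: "\<phi> (6 * M) = \<phi> 0" "\<phi> (6 * M + 1) = \<phi> 1" "\<phi> (6 * M + 2) = \<phi> 2"
    using colour_periodic[of 0] colour_periodic[of 1] colour_periodic[of 2]
    by (simp_all add: M_def add.commute)
  have first: "\<phi> (d + 1) = \<phi> 2" "\<phi> (d + 2) = \<phi> 1" "\<phi> (d + 3) = \<phi> 0"
    using colour_after_2s_odd[of 0] colour_jump[of 0] assms(4) by (simp_all add: u0)
  have second: "\<phi> (3 * M + 1 + d + 1) = \<phi> (3 * M + 3)" "\<phi> (3 * M + 1 + d + 2) = \<phi> (3 * M + 2)"
    "\<phi> (3 * M + 1 + d + 3) = \<phi> (3 * M + 1)"
    using colour_after_2s_odd[of 1] colour_jump[of 1] assms(4) by (simp_all add: u1 add.commute)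
  have run1: "\<phi> y = \<phi> x" if "d < x" "x \<le> d + 3" "3 * M + 1 \<le> y" "y \<le> 3 * M + 3" "3 dvd y - x" for x y
    using colour_after_3s[of 0 x y] that by (simp add: u0 u1)
  have run2: "\<phi> y = \<phi> x" if "3 * M + 1 + d < x" "x \<le> 3 * M + 1 + d + 3" "6 * M \<le> y" "y \<le> 6 * M + 2"
      "3 dvd y - x" for x y
    using colour_after_3s[of 1 x y] that by (simp add: u1 u2)
  have "\<phi> 1 = \<phi> 0 \<and> \<phi> 2 = \<phi> 0 \<and> \<phi> (3 * M + 1) = \<phi> 0 \<and> \<phi> (3 * M + 2) = \<phi> 0 \<and> \<phi> (3 * M + 3) = \<phi> 0"
  proof -
    have "d mod 3 = 0 \<or> d mod 3 = 1 \<or> d mod 3 = 2" by presburger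
    then consider "d mod 3 = 0" | "d mod 3 = 1" | "d mod 3 = 2" by blast
    then show ?thesis
    proof cases
      case 1
      then have "3 dvd 3 * M + 1 - (d + 1)" "3 dvd 3 * M + 2 - (d + 2)" "3 dvd 3 * M + 3 - (d + 3)"
        "3 dvd 6 * M - (3 * M + 1 + d + 2)" "3 dvd 6 * M + 1 - (3 * M + 1 + d + 3)"
        "3 dvd 6 * M + 2 - (3 * M + 1 + d + 1)" by presburger+
      then show ?thesis
        using run1[of "d + 1" "3 * M + 1"] run1[of "d + 2" "3 * M + 2"] run1[of "d + 3" "3 * M + 3"]
          run2[of "3 * M + 1 + d + 2" "6 * M"] run2[of "3 * M + 1 + d + 3" "6 * M + 1"]
          run2[of "3 * M + 1 + d + 1" "6 * M + 2"] first second per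
        by simp
    next
      case 2
      then have "3 dvd 3 * M + 1 - (d + 3)" "3 dvd 3 * M + 2 - (d + 1)" "3 dvd 3 * M + 3 - (d + 2)"
        "3 dvd 6 * M - (3 * M + 1 + d + 1)" "3 dvd 6 * M + 1 - (3 * M + 1 + d + 2)"
        "3 dvd 6 * M + 2 - (3 * M + 1 + d + 3)" by presburger+
      then show ?thesis
        using run1[of "d + 3" "3 * M + 1"] run1[of "d + 1" "3 * M + 2"] run1[of "d + 2" "3 * M + 3"]
          run2[of "3 * M + 1 + d + 1" "6 * M"] run2[of "3 * M + 1 + d + 2" "6 * M + 1"]
          run2[of "3 * M + 1 + d + 3" "6 * M + 2"] first second per
        by simp
    next
      case 3
      then have "3 dvd 3 * M + 1 - (d + 2)" "3 dvd 3 * M + 2 - (d + 3)" "3 dvd 3 * M + 3 - (d + 1)"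
        "3 dvd 6 * M - (3 * M + 1 + d + 3)" "3 dvd 6 * M + 1 - (3 * M + 1 + d + 1)"
        "3 dvd 6 * M + 2 - (3 * M + 1 + d + 2)" by presburger+
      then show ?thesis
        using run1[of "d + 2" "3 * M + 1"] run1[of "d + 3" "3 * M + 2"] run1[of "d + 1" "3 * M + 3"]
          run2[of "3 * M + 1 + d + 3" "6 * M"] run2[of "3 * M + 1 + d + 1" "6 * M + 1"]
          run2[of "3 * M + 1 + d + 2" "6 * M + 2"] first second per
        by simp
    qed
  qed
  then have all: "\<phi> (u 0 + 0) = \<phi> 0" "\<phi> (u 0 + 1) = \<phi> 0" "\<phi> (u 0 + 2) = \<phi> 0"
    "\<phi> (u 1 + 0) = \<phi> 0" "\<phi> (u 1 + 1) = \<phi> 0" "\<phi> (u 1 + 2) = \<phi> 0"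
    by (simp_all add: u0 u1 add.assoc add.commute)
  show "\<phi> x = \<phi> 0"
  proof (rule colour_window)
    fix i q :: int
    assume "0 \<le> i" "i < 2" "q \<in> {0, 1, 2}"
    then have "(i = 0 \<or> i = 1) \<and> (q = 0 \<or> q = 1 \<or> q = 2)" by auto
    then show "\<phi> (u i + q) = \<phi> 0" using all by blast
  qed simp
qed (use assms in auto)

section \<open>Backward jumps: gaps in pairs\<close>

lemma sum_pairs:
  fixes g :: "int \<Rightarrow> int"
  shows "(\<Sum>i\<in>{0..<2 * int j}. g i) = (\<Sum>i<j. g (2 * int i) + g (2 * int i + 1))"
proof (induction j)
  case (Suc j)
  have "{0..<2 * int (Suc j)} = insert (2 * int j) (insert (2 * int j + 1) {0..<2 * int j})"
    by auto
  then show ?case using Suc by simp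
qed simp

text \<open>
  A gap of length \<open>e - 1 - l\<close> is followed by a gap of length \<open>e - 1\<close>.  The slack \<open>l\<close> is the number of arcs of length 3
  in the block that precedes the first of these gaps.  The values of \<open>l\<close> for which the strands around the pair merge into one form four
  of the six residue classes modulo 6, and these classes depend on the parity of \<open>e\<close>.
\<close>

definition merging_slack :: "int \<Rightarrow> int \<Rightarrow> bool" where
  "merging_slack e l \<longleftrightarrow> (if odd (e - l) then l mod 3 \<noteq> 0 else l mod 3 \<noteq> 1)"

text \<open>
  The block from \<open>b\<close> to \<open>u (i + 1)\<close> has length \<open>e - 1\<close>.  Therefore the jump from its end comes back to \<open>b + 2\<close>, and
  the next block has no arcs of length 3.  The strand through \<open>b + 2\<close> returns to \<open>u (i + 1)\<close> and closes up to a separate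
  cycle unless the slack rotates it to another position; for merging slacks it does not close up, and the jumps and
  strands around the pair are all tied together.
\<close>

lemma (in interlacing_colouring) colours_merge_at_pair:
  assumes t: "\<And>i. t i = u (i + 2) - e" and r: "r = -2"
    and A: "u (i + 1) = b + e - 1" and B: "u (i + 2) = u (i + 1) + e - 1 - l" and b: "b = u i"
    and l: "0 \<le> l" "l \<le> e - 2" "merging_slack e l"
    and t': "t (i - 1) = b - 1" "t (i + 1) = u (i + 2) - 1"
  shows "\<phi> (b + 2) = \<phi> (b + 1)" "q \<in> {0, 1, 2} \<Longrightarrow> \<phi> (u (i + 1) + q) = \<phi> (b + 1)"
    "q \<in> {0, 1} \<Longrightarrow> \<phi> (u (i + 2) + q) = \<phi> (b + 1)"
proof -
  define a where "a = u (i + 1)"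
  define s where "s = a - l - 1"
  have ti: "t i = s" using A B by (simp add: t a_def s_def b)
  have u2: "u (i + 2) = s + e" using B by (simp add: a_def s_def)
  have T: "t (i + 1) + 1 = s + e" "t (i + 1) + 2 = s + e + 1"
    by (simp_all add: t' u2)
  have bs: "b = a + 1 - e" using A by (simp add: a_def)
  have j1: "\<phi> (b + 2) = \<phi> a"
    using colour_jump[of "i - 1"] t'(1) by (simp add: r a_def add.commute)
  have j2: "\<phi> (s + 3) = \<phi> (s + e)"
    using colour_jump[of i] by (simp add: r ti u2)
  have run: "\<phi> (a + q) = \<phi> (s + p)" if "p \<in> {1, 2, 3}" "q \<in> {0, 1, 2}" "3 dvd l + 1 + q - p" for p q
    using colour_after_3s[of i "s + p" "a + q"] that by (auto simp: ti a_def s_def algebra_simps)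
  have "\<phi> (b + 2) = \<phi> (b + 1) \<and> \<phi> a = \<phi> (b + 1) \<and> \<phi> (a + 1) = \<phi> (b + 1) \<and> \<phi> (a + 2) = \<phi> (b + 1) \<and>
    \<phi> (s + e) = \<phi> (b + 1) \<and> \<phi> (s + e + 1) = \<phi> (b + 1)"
  proof (cases "odd (e - l)")
    case True
    then have "odd (t i - u i)" "odd (t (i + 1) - u (i + 1))"
      using bs by (auto simp: ti u2 t' a_def[symmetric] s_def b[symmetric])
    from colour_after_2s_odd[OF this(1)] colour_after_2s_odd[OF this(2)]
    have two: "\<phi> (s + 1) = \<phi> (b + 2)" "\<phi> (s + 2) = \<phi> (b + 1)"
      "\<phi> (s + e) = \<phi> (a + 2)" "\<phi> (s + e + 1) = \<phi> (a + 1)"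
      by (simp_all only: ti T b[symmetric] a_def[symmetric])
    \<comment> \<open>the \<open>l\<close> arcs of length 3 rotate the three strands; \<open>run\<close> is used with the resulting matching\<close>
    have "l mod 3 = 1 \<or> l mod 3 = 2" using l(3) True unfolding merging_slack_def by presburger
    then show ?thesis
    proof
      assume "l mod 3 = 1"
      then have "3 dvd l + 1 + 2 - 1" "3 dvd l + 1 + 0 - 2" "3 dvd l + 1 + 1 - 3" by presburger+
      then show ?thesis using run[of 1 2] run[of 2 0] run[of 3 1] j1 j2 two by simp
    next
      assume "l mod 3 = 2"
      then have "3 dvd l + 1 + 1 - 1" "3 dvd l + 1 + 2 - 2" "3 dvd l + 1 + 0 - 3" by presburger+
      then show ?thesis using run[of 1 1] run[of 2 2] run[of 3 0] j1 j2 two by simp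
    qed
  next
    case False
    then have "even (t i - u i)" "even (t (i + 1) - u (i + 1))"
      using bs by (auto simp: ti u2 t' a_def[symmetric] s_def b[symmetric])
    from colour_after_2s_even[OF this(1)] colour_after_2s_even[OF this(2)]
    have two: "\<phi> (s + 1) = \<phi> (b + 1)" "\<phi> (s + 2) = \<phi> (b + 2)"
      "\<phi> (s + e) = \<phi> (a + 1)" "\<phi> (s + e + 1) = \<phi> (a + 2)"
      by (simp_all only: ti T b[symmetric] a_def[symmetric])
    have "l mod 3 = 0 \<or> l mod 3 = 2" using l(3) False unfolding merging_slack_def by presburger
    then show ?thesis
    proof
      assume "l mod 3 = 0"
      then have "3 dvd l + 1 + 0 - 1" "3 dvd l + 1 + 1 - 2" "3 dvd l + 1 + 2 - 3" by presburger+
      then show ?thesis using run[of 1 0] run[of 2 1] run[of 3 2] j1 j2 two by simp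
    next
      assume "l mod 3 = 2"
      then have "3 dvd l + 1 + 1 - 1" "3 dvd l + 1 + 2 - 2" "3 dvd l + 1 + 0 - 3" by presburger+
      then show ?thesis using run[of 1 1] run[of 2 2] run[of 3 0] j1 j2 two by simp
    qed
  qed
  then show "\<phi> (b + 2) = \<phi> (b + 1)" "q \<in> {0, 1, 2} \<Longrightarrow> \<phi> (u (i + 1) + q) = \<phi> (b + 1)"
    "q \<in> {0, 1} \<Longrightarrow> \<phi> (u (i + 2) + q) = \<phi> (b + 1)"
    by (auto simp: a_def[symmetric] u2)
qed

text \<open>
  Neighbouring pairs share the position \<open>u (2 i + 3) + 1\<close>, so the merged colours agree all around the circle.  The
  jumps have length \<open>3 - e\<close> and go back by two blocks, hence \<open>r = -2\<close>.
\<close>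

lemma hamiltonian_of_gap_pairs:
  fixes e c :: int and l :: "nat \<Rightarrow> int"
  assumes "n > 0" "j > 0" and l: "\<And>i. i < j \<Longrightarrow> 0 \<le> l i \<and> l i \<le> e - 2 \<and> merging_slack e (l i)"
    and sum: "(\<Sum>i<j. l i) = 2 * int j * (e - 1) - int n"
    and c: "[3 - e = c] (mod int n)"
  shows "hamiltonian (with_proj (circ n {2, 3, c}))"
proof -
  define slack where "slack i = l (nat (i mod int j))" for i
  have slack: "0 \<le> slack i" "slack i \<le> e - 2" "merging_slack e (slack i)" for i
  proof -
    have "nat (i mod int j) < j" using assms(2) by (simp add: nat_less_iff)
    from l[OF this] show "0 \<le> slack i" "slack i \<le> e - 2" "merging_slack e (slack i)"
      by (auto simp: slack_def)
  qed
  define g where "g i = (if even i then e - 1 - slack (i div 2) else e - 1)" for i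
  show ?thesis
  proof (rule hamiltonian_of_gaps[where k = "2 * int j" and r = "-2" and d = "- e" and g = g])
    show "g (i + 2 * int j) = g i" for i
      by (simp add: g_def slack_def)
    have "(\<Sum>i<j. g (2 * int i) + g (2 * int i + 1)) = (\<Sum>i<j. 2 * (e - 1) - l i)"
      by (intro sum.cong) (auto simp: g_def slack_def)
    also have "\<dots> = int n"
      using sum by (simp add: sum_subtractf mult.assoc mult.left_commute)
    finally show "(\<Sum>i\<in>{0..<2 * int j}. g i) = int n"
      by (simp add: sum_pairs)
    show "u i \<le> u (i - - 2) + - e \<and> u (i - - 2) + - e < u (i + 1)"
      if "\<And>i. u (i + 1) = u i + g i" for u i
      using that[of i] that[of "i + 1"] slack(1,2)[of "i div 2"] slack(1,2)[of "(i + 1) div 2"]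
      by (auto simp: g_def add.assoc)
  next
    fix u \<phi> x
    assume u: "\<And>i. u (i + 1) = u i + g i"
      and "interlacing_colouring n (2 * int j) (- 2) (- e) u (\<lambda>i. u (i - - 2) + - e) \<phi>"
    then interpret interlacing_colouring n "2 * int j" "-2" "- e" u "\<lambda>i. u (i - - 2) + - e" \<phi>
      by simp
    have even_step: "u (2 * i + 1) = u (2 * i) + e - 1 - slack i" for i
      using u[of "2 * i"] by (simp add: g_def)
    have odd_step: "u (2 * i + 2) = u (2 * i + 1) + e - 1" for i
      using u[of "2 * i + 1"] by (simp add: g_def add.assoc)
    have even_step': "u (2 * i + 3) = u (2 * i + 2) + e - 1 - slack (i + 1)" for i
      using even_step[of "i + 1"] by (simp add: algebra_simps)
    have odd_step': "u (2 * i + 4) = u (2 * i + 3) + e - 1" for i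
      using odd_step[of "i + 1"] by (simp add: algebra_simps)
    \<comment> \<open>the common colour at the \<open>i\<close>-th pair\<close>
    define \<psi> where "\<psi> i = \<phi> (u (2 * i + 1) + 1)" for i
    have merge: "\<phi> (u (2 * i + 1) + 2) = \<psi> i"
      "q \<in> {0, 1, 2} \<Longrightarrow> \<phi> (u (2 * i + 2) + q) = \<psi> i"
      "q \<in> {0, 1} \<Longrightarrow> \<phi> (u (2 * i + 3) + q) = \<psi> i" for i q
    proof -
      have "u (2 * i + 1 + 1) = u (2 * i + 1) + e - 1"
        "u (2 * i + 1 + 2) = u (2 * i + 1 + 1) + e - 1 - slack (i + 1)"
        "u (2 * i + 1 - 1 - - 2) + - e = u (2 * i + 1) - 1"
        "u (2 * i + 1 + 1 - - 2) + - e = u (2 * i + 1 + 2) - 1"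
        using odd_step[of i] even_step'[of i] odd_step'[of i] by (simp_all add: add.assoc)
      note merges = colours_merge_at_pair[of e "2 * i + 1", OF _ refl this(1,2) refl slack this(3,4)]
      show "\<phi> (u (2 * i + 1) + 2) = \<psi> i"
        using merges(1) by (simp add: \<psi>_def)
      show "\<phi> (u (2 * i + 2) + q) = \<psi> i" if "q \<in> {0, 1, 2}"
        using merges(2)[OF _ that] by (simp add: \<psi>_def add.assoc)
      show "\<phi> (u (2 * i + 3) + q) = \<psi> i" if "q \<in> {0, 1}"
        using merges(3)[OF _ that] by (simp add: \<psi>_def add.assoc)
    qed
    have "\<psi> (i + 1) = \<psi> i" for i
      using merge(3)[of 1 i] by (simp add: \<psi>_def algebra_simps)
    then have \<psi>: "\<psi> i = \<psi> 0" for i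
      using invariant_multiple[where \<phi> = \<psi> and a = 1 and x = 0 and q = i] by simp
    have "\<phi> (u i + q) = \<psi> 0" if "q \<in> {0, 1, 2}" for i q
    proof (cases "even i")
      case True
      then obtain h where "i = 2 * (h - 1) + 2" by (metis evenE diff_add_cancel distrib_left mult_2_right one_add_one mult.right_neutral)
      then show ?thesis using merge(2)[OF that, of "h - 1"] \<psi> by simp
    next
      case False
      then obtain h where h: "i = 2 * h + 1" by (metis oddE)
      then have h': "i = 2 * (h - 1) + 3" by simp
      have "q \<in> {0, 1} \<or> q = 2" using that by auto
      then show ?thesis
        using merge(1)[of h] merge(3)[of q "h - 1"] \<psi>[of h] \<psi>[of "h - 1"]
        by (elim disjE) (simp only: h', simp only: h)
    qed
    then have "\<phi> y = \<psi> 0" for y by (rule colour_constant)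
    then show "\<phi> x = \<phi> 0" by simp
  qed (use assms in auto)
qed

text \<open>
  Induction on the number of summands: an extreme value \<open>lo\<close> or \<open>hi\<close> can be split off until two summands are left.
  So only the sums of two admissible values have to be examined.
\<close>

lemma ex_bounded_summands:
  fixes lo hi z :: int
  assumes "lo \<le> hi" "P lo" "P hi" "j \<ge> 2"
    and pair: "\<And>z. 2 * lo \<le> z \<Longrightarrow> z \<le> 2 * hi \<Longrightarrow>
      \<exists>x y. x + y = z \<and> lo \<le> x \<and> x \<le> hi \<and> P x \<and> lo \<le> y \<and> y \<le> hi \<and> P y"
    and "int j * lo \<le> z" "z \<le> int j * hi"
  shows "\<exists>l. (\<forall>i<j. lo \<le> l i \<and> l i \<le> hi \<and> P (l i)) \<and> (\<Sum>i<j. l i) = z"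
  using assms(4,6,7)
proof (induction j arbitrary: z rule: dec_induct)
  case base
  obtain x y where xy: "x + y = z" "lo \<le> x" "x \<le> hi" "P x" "lo \<le> y" "y \<le> hi" "P y"
    using pair[of z] base by auto
  show ?case
    by (rule exI[of _ "\<lambda>i. if i = 0 then x else y"])
      (use xy in \<open>auto simp: numeral_2_eq_2\<close>)
next
  case (step j)
  define w where "w = (if z - lo \<le> int j * hi then lo else hi)"
  have "int j * lo \<le> z - w \<and> z - w \<le> int j * hi"
  proof (cases "z - lo \<le> int j * hi")
    case True
    then show ?thesis using step.prems by (simp add: w_def algebra_simps)
  next
    case False
    have "0 \<le> (int j - 1) * (hi - lo)" using step.hyps assms(1) by simp
    then have "int j * lo + hi \<le> int j * hi + lo" by (simp add: algebra_simps)
    then show ?thesis using False step.prems by (simp add: w_def algebra_simps)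
  qed
  then obtain l where l: "\<forall>i<j. lo \<le> l i \<and> l i \<le> hi \<and> P (l i)" "(\<Sum>i<j. l i) = z - w"
    using step.IH[of "z - w"] by blast
  have "lo \<le> w \<and> w \<le> hi \<and> P w" using assms(1-3) by (simp add: w_def)
  then have "\<forall>i<Suc j. lo \<le> (l(j := w)) i \<and> (l(j := w)) i \<le> hi \<and> P ((l(j := w)) i)"
    using l(1) by (auto simp: less_Suc_eq)
  moreover have "(\<Sum>i<Suc j. (l(j := w)) i) = z" using l(2) by simp
  ultimately show ?case by blast
qed

text \<open>
  For odd \<open>e\<close> the merging slacks are those with residue at least 2 modulo 6.  A small total is met with 3, 4 or 5 as
  one summand, a large one with \<open>hi\<close>, \<open>hi - 1\<close> or \<open>hi - 2\<close>.
\<close>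

lemma ex_two_slacks_from_3:
  fixes z hi :: int
  assumes "hi mod 6 = 5" "6 \<le> z" "z \<le> 2 * hi"
  shows "\<exists>x y. x + y = z \<and> 3 \<le> x \<and> x \<le> hi \<and> 2 \<le> x mod 6 \<and> 3 \<le> y \<and> y \<le> hi \<and> 2 \<le> y mod 6"
proof -
  obtain h where h: "hi = 6 * h + 5" using assms(1) by (metis mult_div_mod_eq)
  define w where "w = z div 6"
  have "z mod 6 = 0 \<or> z mod 6 = 1 \<or> z mod 6 = 2 \<or> z mod 6 = 3 \<or> z mod 6 = 4 \<or> z mod 6 = 5"
    by presburger
  moreover have "z = 6 * w + z mod 6" by (simp add: w_def)
  ultimately have z: "z = 6 * w \<or> z = 6 * w + 1 \<or> z = 6 * w + 2 \<or> z = 6 * w + 3 \<or>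
      z = 6 * w + 4 \<or> z = 6 * w + 5"
    by (elim disjE) simp_all
  define x where "x = (if z \<le> hi + 3 then if z = 6 * w + 4 then 5 else if z = 6 * w + 3 then 4 else 3
    else if z = 6 * w + 5 then 6 * h + 3 else if z = 6 * w then 6 * h + 4 else 6 * h + 5)"
  have mods: "(6 * v + 2) mod 6 = 2" "(6 * v + 3) mod 6 = 3" "(6 * v + 4) mod 6 = 4" "(6 * v + 5) mod 6 = 5"
    for v :: int by presburger+
  have "3 \<le> x \<and> x \<le> hi \<and> 3 \<le> z - x \<and> z - x \<le> hi"
    using z assms(2,3) unfolding x_def h by (auto split: if_splits; presburger)
  moreover have "2 \<le> x mod 6" unfolding x_def by (auto simp: mods)
  moreover have "\<exists>v. z - x = 6 * v + 2 \<or> z - x = 6 * v + 3 \<or> z - x = 6 * v + 4 \<or> z - x = 6 * v + 5"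
    using z unfolding x_def h by (auto split: if_splits) presburger+
  then have "2 \<le> (z - x) mod 6" using mods by fastforce
  ultimately show ?thesis by (intro exI[of _ x] exI[of _ "z - x"]) simp
qed

lemma ex_two_slacks_from_2:
  fixes z hi :: int
  assumes "hi mod 6 = 5" "2 * 2 \<le> z" "z \<le> 2 * hi"
  shows "\<exists>x y. x + y = z \<and> 2 \<le> x \<and> x \<le> hi \<and> 2 \<le> x mod 6 \<and> 2 \<le> y \<and> y \<le> hi \<and> 2 \<le> y mod 6"
proof -
  consider "z = 4" | "z = 5" | "6 \<le> z" using assms(2) by linarith
  then show ?thesis
  proof cases
    case 1
    then show ?thesis using assms by (intro exI[of _ 2]) simp
  next
    case 2
    then show ?thesis using assms by (intro exI[of _ 2] exI[of _ 3]) simp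
  next
    case 3
    obtain x y where "x + y = z" "3 \<le> x" "x \<le> hi" "2 \<le> x mod 6" "3 \<le> y" "y \<le> hi" "2 \<le> y mod 6"
      using ex_two_slacks_from_3[OF assms(1) 3 assms(3)] by blast
    then show ?thesis by (intro exI[of _ x] exI[of _ y]) simp
  qed
qed

text \<open>
  With \<open>j\<close> pairs the slacks have to add up to \<open>2 j (e - 1) - n\<close>, and a pair is shortest, of length
  \<open>2 e - 2 - hi\<close>, if its slack is as large as possible.  The largest possible number of pairs is taken; then the
  slacks only have to absorb the remainder.
\<close>

lemma ex_number_of_pairs:
  fixes n e lo hi :: int
  assumes "n \<ge> 2 * (2 * e - 2 - hi)" "0 < 2 * e - 2 - hi"
    and "n mod (2 * e - 2 - hi) \<le> (n div (2 * e - 2 - hi)) * (hi - lo)"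
  shows "\<exists>j::nat. j \<ge> 2 \<and> int j * lo \<le> 2 * int j * (e - 1) - n \<and> 2 * int j * (e - 1) - n \<le> int j * hi"
proof -
  define A where "A = 2 * e - 2 - hi"
  define j where "j = nat (n div A)"
  have A: "0 < A" "2 * A \<le> n" "n mod A \<le> (n div A) * (hi - lo)"
    using assms unfolding A_def by blast+
  have "2 = (2 * A) div A" using A(1) by simp
  also have "\<dots> \<le> n div A" using A(2,1) by (rule zdiv_mono1)
  finally have ge: "2 \<le> n div A" .
  then have j: "int j = n div A" unfolding j_def by linarith
  have "n = int j * A + n mod A" unfolding j by (rule div_mult_mod_eq[symmetric])
  moreover have "0 \<le> n mod A" using A(1) by (rule pos_mod_sign)
  moreover have "n mod A \<le> int j * hi - int j * lo"
    using A(3) unfolding j right_diff_distrib .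
  moreover have "int j * A = 2 * int j * (e - 1) - int j * hi"
    unfolding A_def by (simp add: algebra_simps)
  ultimately have "int j * lo \<le> 2 * int j * (e - 1) - n" "2 * int j * (e - 1) - n \<le> int j * hi"
    by linarith+
  moreover have "2 \<le> j" using ge j by linarith
  ultimately show ?thesis by blast
qed

text \<open>
  The bounds \<open>lo\<close> and \<open>hi\<close> are the extreme merging slacks that are used: \<open>(2, e - 2)\<close> and \<open>(2, e - 4)\<close> for \<open>e\<close> equal to 1
  and 3 modulo 6, and \<open>(0, e - 4)\<close> for \<open>e\<close> divisible by 6.  For \<open>e\<close> equal to 5 modulo 6 all slacks are taken equal
  to 2 modulo 6.  The remainder of \<open>n\<close> modulo the shortest pair can be absorbed if there are at least two pairs and
  \<open>e\<close> is not very small; the small values of \<open>e\<close> are treated separately.  For \<open>e = 9\<close> and \<open>m = 5\<close> there is no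
  solution, because two pairs have length at most 28 and three have length at least 33.
\<close>

lemma ex_merging_slacks:
  fixes m :: nat and e :: int
  assumes "odd e \<and> 5 \<le> e \<and> e < 3 * int m \<and> \<not> (e = 9 \<and> m = 5) \<or> 6 dvd e \<and> 6 \<le> e \<and> e < 3 * int m"
  shows "\<exists>j l. j > 0 \<and> (\<forall>i<j. 0 \<le> l i \<and> l i \<le> e - 2 \<and> merging_slack e (l i)) \<and>
    (\<Sum>i<j. l i) = 2 * int j * (e - 1) - 6 * int m"
proof -
  have pairs_suffice: ?thesis
    if count: "n \<ge> 2 * (2 * e - 2 - hi)" "0 < 2 * e - 2 - hi" and n: "n = 6 * int m"
      and rem: "n mod (2 * e - 2 - hi) \<le> (n div (2 * e - 2 - hi)) * (hi - lo)"
      and lo: "0 \<le> lo" "lo \<le> hi" "hi \<le> e - 2" "P lo" "P hi"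
      and good: "\<And>x. P x \<Longrightarrow> merging_slack e x"
      and pair: "\<And>z. 2 * lo \<le> z \<Longrightarrow> z \<le> 2 * hi \<Longrightarrow>
        \<exists>x y. x + y = z \<and> lo \<le> x \<and> x \<le> hi \<and> P x \<and> lo \<le> y \<and> y \<le> hi \<and> P y"
    for n lo hi :: int and P
  proof -
    obtain j :: nat where j: "2 \<le> j" "int j * lo \<le> 2 * int j * (e - 1) - n"
      "2 * int j * (e - 1) - n \<le> int j * hi"
      using ex_number_of_pairs[OF count rem] by blast
    obtain l where l: "\<forall>i<j. lo \<le> l i \<and> l i \<le> hi \<and> P (l i)" "(\<Sum>i<j. l i) = 2 * int j * (e - 1) - n"
      using ex_bounded_summands[OF lo(2,4,5) j(1) pair j(2,3)] by blast
    have "\<forall>i<j. 0 \<le> l i \<and> l i \<le> e - 2 \<and> merging_slack e (l i)"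
      using l(1) lo(1,3) good by (meson order_trans)
    then show ?thesis using l(2) j(1) n by (intro exI[of _ j] exI[of _ l]) simp
  qed
  have bound: "n mod A \<le> (n div A) * r" if "0 < A" "2 * A \<le> n" "A - 1 \<le> 2 * r" for n A r :: int
  proof -
    have "2 = (2 * A) div A" using that(1) by simp
    also have "\<dots> \<le> n div A" using that(2,1) by (rule zdiv_mono1)
    finally have "2 * r \<le> (n div A) * r" using that(1,3) by (intro mult_right_mono) auto
    then show ?thesis using pos_mod_bound[OF that(1), of n] that(3) by linarith
  qed
  have odd_good: "merging_slack e x" if "odd e" "2 \<le> x mod 6" for x
    using that unfolding merging_slack_def by presburger
  define n where "n = 6 * int m"
  have e5: "5 \<le> e" and em: "e < 3 * int m" using assms by auto
  have en: "2 * e + 2 \<le> n" using em by (simp add: n_def)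
  have "odd e \<or> 6 dvd e" using assms by blast
  then have "e mod 6 = 0 \<or> e mod 6 = 1 \<or> e mod 6 = 3 \<or> e mod 6 = 5" by presburger
  then show ?thesis
  proof (elim disjE)
    assume e: "e mod 6 = 1"
    then have "odd e" "7 \<le> e" using e5 by presburger+
    show ?thesis
    proof (rule pairs_suffice[of "e - 2" n 2 "\<lambda>x. 2 \<le> x mod 6"])
      show "n mod (2 * e - 2 - (e - 2)) \<le> n div (2 * e - 2 - (e - 2)) * (e - 2 - 2)"
        using \<open>7 \<le> e\<close> en by (intro bound) simp_all
      show "2 \<le> (e - 2) mod 6" using e by presburger
      show "\<exists>x y. x + y = z \<and> 2 \<le> x \<and> x \<le> e - 2 \<and> 2 \<le> x mod 6 \<and> 2 \<le> y \<and> y \<le> e - 2 \<and> 2 \<le> y mod 6"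
        if "2 * 2 \<le> z" "z \<le> 2 * (e - 2)" for z
      proof -
        have "(e - 2) mod 6 = 5" using e by presburger
        from ex_two_slacks_from_2[OF this that] show ?thesis .
      qed
    qed (use \<open>7 \<le> e\<close> en odd_good[OF \<open>odd e\<close>] in \<open>simp_all add: n_def\<close>)
  next
    assume e: "e mod 6 = 3"
    then have "odd e" "9 \<le> e" "e + 3 \<le> 3 * int m" using e5 em by presburger+
    then have "2 * e + 6 \<le> n" by (simp add: n_def)
    show ?thesis
    proof (rule pairs_suffice[of "e - 4" n 2 "\<lambda>x. 2 \<le> x mod 6"])
      show "n mod (2 * e - 2 - (e - 4)) \<le> n div (2 * e - 2 - (e - 4)) * (e - 4 - 2)"
      proof (cases "e = 9")
        case True
        then have "m \<noteq> 5" using assms by auto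
        moreover have "4 \<le> m" using em True by simp
        ultimately consider "m = 4" | "m = 6" | "m = 7" | "8 \<le> m" by linarith
        then have "n mod 11 \<le> n div 11 * 3"
        proof cases
          case 4
          then have "44 div 11 \<le> n div 11" by (intro zdiv_mono1) (simp_all add: n_def)
          then show ?thesis using pos_mod_bound[of 11 n] by linarith
        qed (simp_all add: n_def)
        then show ?thesis using True by simp
      next
        case False
        then have "15 \<le> e" using \<open>9 \<le> e\<close> e by presburger
        then show ?thesis using \<open>2 * e + 6 \<le> n\<close> by (intro bound) simp_all
      qed
      show "2 \<le> (e - 4) mod 6" using e by presburger
      show "\<exists>x y. x + y = z \<and> 2 \<le> x \<and> x \<le> e - 4 \<and> 2 \<le> x mod 6 \<and> 2 \<le> y \<and> y \<le> e - 4 \<and> 2 \<le> y mod 6"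
        if "2 * 2 \<le> z" "z \<le> 2 * (e - 4)" for z
      proof -
        have "(e - 4) mod 6 = 5" using e by presburger
        from ex_two_slacks_from_2[OF this that] show ?thesis .
      qed
    qed (use \<open>9 \<le> e\<close> \<open>2 * e + 6 \<le> n\<close> odd_good[OF \<open>odd e\<close>] in \<open>simp_all add: n_def\<close>)
  next
    assume e: "e mod 6 = 0"
    then have "even e" "6 \<le> e" "e + 3 \<le> 3 * int m" using e5 em by presburger+
    then have e': "even e" "6 \<le> e" "2 * e + 6 \<le> n" by (simp_all add: n_def)
    show ?thesis
    \<comment> \<open>for even \<open>e\<close> the merging slacks are those for odd \<open>e\<close>, shifted by 3\<close>
    proof (rule pairs_suffice[of "e - 4" n 0 "\<lambda>x. 2 \<le> (x + 3) mod 6"])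
      show "n mod (2 * e - 2 - (e - 4)) \<le> n div (2 * e - 2 - (e - 4)) * (e - 4 - 0)"
      proof (cases "e = 6")
        case True
        then have "3 \<le> m" using em by simp
        then consider "m = 3" | "m = 4" | "m = 5" | "6 \<le> m" by linarith
        then have "n mod 8 \<le> n div 8 * 2"
        proof cases
          case 4
          then have "32 div 8 \<le> n div 8" by (intro zdiv_mono1) (simp_all add: n_def)
          then show ?thesis using pos_mod_bound[of 8 n] by linarith
        qed (simp_all add: n_def)
        then show ?thesis using True by simp
      next
        case False
        then have "12 \<le> e" using e' e by presburger
        then show ?thesis using \<open>2 * e + 6 \<le> n\<close> by (intro bound) simp_all
      qed
      show "2 \<le> (e - 4 + 3) mod 6" using e by presburger
      show "merging_slack e x" if "2 \<le> (x + 3) mod 6" for x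
        using that e'(1) unfolding merging_slack_def by presburger
      show "\<exists>x y. x + y = z \<and> 0 \<le> x \<and> x \<le> e - 4 \<and> 2 \<le> (x + 3) mod 6 \<and> 0 \<le> y \<and> y \<le> e - 4 \<and> 2 \<le> (y + 3) mod 6"
        if "2 * 0 \<le> z" "z \<le> 2 * (e - 4)" for z
      proof -
        have "(e - 1) mod 6 = 5" using e by presburger
        then obtain x y where "x + y = z + 6" "3 \<le> x" "x \<le> e - 1" "2 \<le> x mod 6"
          "3 \<le> y" "y \<le> e - 1" "2 \<le> y mod 6"
          using ex_two_slacks_from_3[of "e - 1" "z + 6"] \<open>2 * 0 \<le> z\<close> \<open>z \<le> 2 * (e - 4)\<close> by auto
        then show ?thesis by (intro exI[of _ "x - 3"] exI[of _ "y - 3"]) simp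
      qed
    qed (use e' in \<open>simp_all add: n_def\<close>)
  next
    assume e: "e mod 6 = 5"
    then have "odd e" by presburger
    with e5 en have e': "odd e" "5 \<le> e" "2 * e + 2 \<le> n" by simp_all
    \<comment> \<open>the slacks are \<open>6 l + 2\<close> with \<open>0 \<le> l \<le> h\<close>, so a pair has a length between \<open>6 (h + 1)\<close> and \<open>6 (2 h + 1)\<close>\<close>
    define h where "h = e div 6"
    have h: "e = 6 * h + 5" using mult_div_mod_eq[of 6 e] e unfolding h_def by linarith
    define A where "A = h + 1"
    define j where "j = nat (int m div A)"
    have "0 \<le> h" using e'(2) h by simp
    then have "0 < A" by (simp add: A_def)
    have "2 * A \<le> int m" using e'(3) h by (simp add: n_def A_def)
    have "2 = (2 * A) div A" using \<open>0 < A\<close> by simp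
    also have "\<dots> \<le> int m div A" using \<open>2 * A \<le> int m\<close> \<open>0 < A\<close> by (rule zdiv_mono1)
    finally have "2 \<le> int m div A" .
    then have j: "2 \<le> j" "int j = int m div A" unfolding j_def by linarith+
    define w where "w = int j * (2 * h + 1) - int m"
    have "int m = int j * A + int m mod A" unfolding j by (rule div_mult_mod_eq[symmetric])
    moreover have "int j * A = int j * h + int j" "int j * (2 * h + 1) = 2 * (int j * h) + int j"
      by (simp_all add: A_def algebra_simps)
    moreover have "0 \<le> int m mod A" "int m mod A \<le> h"
      using pos_mod_bound[OF \<open>0 < A\<close>, of "int m"] \<open>0 < A\<close> by (simp_all add: A_def)
    moreover have "h \<le> int j * h" using \<open>0 \<le> h\<close> j(1) mult_right_mono[of 1 "int j" h] by simp
    ultimately have w: "int j * 0 \<le> w" "w \<le> int j * h" unfolding w_def by linarith+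
    have "\<exists>x y. x + y = z \<and> 0 \<le> x \<and> x \<le> h \<and> True \<and> 0 \<le> y \<and> y \<le> h \<and> True"
      if "2 * 0 \<le> z" "z \<le> 2 * h" for z
      using that \<open>0 \<le> h\<close> by (intro exI[of _ "min z h"] exI[of _ "z - min z h"]) auto
    from ex_bounded_summands[of 0 h "\<lambda>_. True", OF \<open>0 \<le> h\<close> TrueI TrueI j(1) this w]
    obtain l where l: "\<forall>i<j. 0 \<le> l i \<and> l i \<le> h" "(\<Sum>i<j. l i) = w" by blast
    have "\<forall>i<j. 0 \<le> 6 * l i + 2 \<and> 6 * l i + 2 \<le> e - 2 \<and> merging_slack e (6 * l i + 2)"
    proof (intro allI impI)
      fix i assume "i < j"
      have "(6 * l i + 2) mod 6 = 2" by presburger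
      then have "merging_slack e (6 * l i + 2)" using odd_good[OF \<open>odd e\<close>] by simp
      then show "0 \<le> 6 * l i + 2 \<and> 6 * l i + 2 \<le> e - 2 \<and> merging_slack e (6 * l i + 2)"
        using l(1) \<open>i < j\<close> h by auto
    qed
    moreover have "(\<Sum>i<j. 6 * l i + 2) = 6 * w + 2 * int j"
      using l(2) by (simp add: sum.distrib flip: sum_distrib_left)
    then have "(\<Sum>i<j. 6 * l i + 2) = 2 * int j * (e - 1) - 6 * int m"
      by (simp add: w_def h algebra_simps)
    ultimately show ?thesis using j(1) by (intro exI[of _ j] exI[of _ "\<lambda>i. 6 * l i + 2"]) simp
  qed
qed

text \<open>
  The case \<open>e = 9\<close>, \<open>m = 5\<close>, which pairs of gaps do not reach.  The cycle comes from the gaps 3, 6, 3, 6, 4, 8.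
\<close>

lemma hamiltonian_30:
  assumes "[24 = c] (mod 30)"
  shows "hamiltonian (with_proj (circ 30 {2, 3, c}))"
proof -
  define vs :: "int list" where "vs = [0, 24, 26, 29, 2, 5, 8, 11, 14, 17, 20, 22, 16, 19, 21,
    23, 25, 28, 1, 4, 7, 10, 13, 15, 18, 12, 6, 9, 3, 27]"
  have len: "length vs = 30" by (simp add: vs_def)
  have dist: "distinct vs" by (simp add: vs_def)
  have "set vs \<subseteq> {0..<30}" by (simp add: vs_def)
  moreover have "card (set vs) = card {0..<30 :: int}" using distinct_card[OF dist] len by simp
  ultimately have set: "set vs = {0..<30}" by (intro card_subset_eq) auto
  have "list_all2 (\<lambda>v w. w = (v + 2) mod 30 \<or> w = (v + 3) mod 30 \<or> w = (v + 24) mod 30) vs (rotate1 vs)"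
    by (simp add: vs_def)
  then have arcs: "vs ! (Suc i mod 30) = (vs ! i + 2) mod 30 \<or> vs ! (Suc i mod 30) = (vs ! i + 3) mod 30 \<or>
      vs ! (Suc i mod 30) = (vs ! i + 24) mod 30" if "i < 30" for i
    using that len by (auto simp: list_all2_conv_all_nth nth_rotate1)
  have c: "(v + 24) mod 30 = (v + c) mod 30" for v
    using cong_add[OF cong_refl assms, of v] by (simp add: cong_def)
  have "\<exists>s\<in>{2, 3, c}. vs ! (Suc i mod 30) = (vs ! i + s) mod int 30" if "i < 30" for i
    using arcs[OF that] unfolding c by auto
  then show ?thesis
    using dist set by (subst hamiltonian_circ_iff) auto
qed

lemma hamiltonian_backward_jump:
  fixes m :: nat and e c :: int
  assumes "odd e \<and> 5 \<le> e \<and> e < 3 * int m \<or> 6 dvd e \<and> 6 \<le> e \<and> e < 3 * int m"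
    and c: "[3 - e = c] (mod int (6 * m))"
  shows "hamiltonian (with_proj (circ (6 * m) {2, 3, c}))"
proof (cases "e = 9 \<and> m = 5")
  case True
  have "[24 = - 6 :: int] (mod 30)" by (simp add: cong_def)
  moreover have "[- 6 = c] (mod 30)" using True c by simp
  ultimately have "[24 = c] (mod 30)" by (rule cong_trans)
  then show ?thesis using True hamiltonian_30 by simp
next
  case False
  then have "odd e \<and> 5 \<le> e \<and> e < 3 * int m \<and> \<not> (e = 9 \<and> m = 5) \<or> 6 dvd e \<and> 6 \<le> e \<and> e < 3 * int m"
    using assms(1) by blast
  from ex_merging_slacks[OF this] obtain j l where l: "j > 0"
    "\<forall>i<j. 0 \<le> l i \<and> l i \<le> e - 2 \<and> merging_slack e (l i)"
    "(\<Sum>i<j. l i) = 2 * int j * (e - 1) - 6 * int m" by blast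
  show ?thesis
    by (rule hamiltonian_of_gap_pairs[where l = l and j = j and e = e]) (use l assms in auto)
qed

section \<open>Forward jumps of an offset divisible by six\<close>

text \<open>
  The landing points satisfy \<open>t i = u (i - 1) + d\<close>, and \<open>d\<close> is divisible by 3, so a strand behind \<open>t i\<close> is known by its
  residue relative to \<open>p = u (i - 1)\<close>: the jump from \<open>p\<close> has residue 0, and the two strands from the start of the
  block have residues 1 and 2, in the order given by parity.
\<close>

lemma (in interlacing_colouring) colour_block_even:
  assumes "t i = u (i - 1) + d" "r = 1" "3 dvd d"
    and u: "u (i - 1) = p" "u i = c" "u (i + 1) = v" and par: "even (p + d - c)"
  shows "v \<le> y \<Longrightarrow> y \<le> v + 2 \<Longrightarrow> 3 dvd y - p \<Longrightarrow> \<phi> y = \<phi> p"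
    "v \<le> y \<Longrightarrow> y \<le> v + 2 \<Longrightarrow> 3 dvd y - p - 1 \<Longrightarrow> \<phi> y = \<phi> (c + 1)"
    "v \<le> y \<Longrightarrow> y \<le> v + 2 \<Longrightarrow> 3 dvd y - p - 2 \<Longrightarrow> \<phi> y = \<phi> (c + 2)"
proof -
  have t: "even (t i - u i)" using assms(1) u par by simp
  have run: "\<phi> y = \<phi> (t i + h)" if "h \<in> {1, 2, 3}" "3 dvd y - p - h" "v \<le> y" "y \<le> v + 2" for h
  proof -
    have "y - (t i + h) = (y - p - h) - d" using assms(1) u by simp
    then have "3 dvd y - (t i + h)" using that(2) assms(3) by (simp only: dvd_diff)
    then show ?thesis using colour_after_3s[of i "t i + h" y] that u by auto
  qed
  assume y: "v \<le> y" "y \<le> v + 2"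
  show "3 dvd y - p - 1 \<Longrightarrow> \<phi> y = \<phi> (c + 1)" "3 dvd y - p - 2 \<Longrightarrow> \<phi> y = \<phi> (c + 2)"
    using run[of 1] run[of 2] y colour_after_2s_even[OF t] u by simp_all
  assume "3 dvd y - p"
  then have "3 dvd y - p - 3" by simp
  then show "\<phi> y = \<phi> p" using run[of 3] y colour_jump[of i] assms(2) u by simp
qed

lemma (in interlacing_colouring) colour_block_odd:
  assumes "t i = u (i - 1) + d" "r = 1" "3 dvd d"
    and u: "u (i - 1) = p" "u i = c" "u (i + 1) = v" and par: "odd (p + d - c)"
  shows "v \<le> y \<Longrightarrow> y \<le> v + 2 \<Longrightarrow> 3 dvd y - p \<Longrightarrow> \<phi> y = \<phi> p"
    "v \<le> y \<Longrightarrow> y \<le> v + 2 \<Longrightarrow> 3 dvd y - p - 1 \<Longrightarrow> \<phi> y = \<phi> (c + 2)"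
    "v \<le> y \<Longrightarrow> y \<le> v + 2 \<Longrightarrow> 3 dvd y - p - 2 \<Longrightarrow> \<phi> y = \<phi> (c + 1)"
proof -
  have t: "odd (t i - u i)" using assms(1) u par by simp
  have run: "\<phi> y = \<phi> (t i + h)" if "h \<in> {1, 2, 3}" "3 dvd y - p - h" "v \<le> y" "y \<le> v + 2" for h
  proof -
    have "y - (t i + h) = (y - p - h) - d" using assms(1) u by simp
    then have "3 dvd y - (t i + h)" using that(2) assms(3) by (simp only: dvd_diff)
    then show ?thesis using colour_after_3s[of i "t i + h" y] that u by auto
  qed
  assume y: "v \<le> y" "y \<le> v + 2"
  show "3 dvd y - p - 1 \<Longrightarrow> \<phi> y = \<phi> (c + 2)" "3 dvd y - p - 2 \<Longrightarrow> \<phi> y = \<phi> (c + 1)"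
    using run[of 1] run[of 2] y colour_after_2s_odd[OF t] u by simp_all
  assume "3 dvd y - p"
  then have "3 dvd y - p - 3" by simp
  then show "\<phi> y = \<phi> p" using run[of 3] y colour_jump[of i] assms(2) u by simp
qed

text \<open>
  In a run of gaps equal to \<open>d\<close> no arc has length 2.  The two strands behind each \<open>u i\<close> pass straight through, and
  the long arcs alternate between two strands that use every second \<open>u i\<close>.
\<close>

lemma (in interlacing_colouring) run_of_full_gaps:
  assumes t: "\<And>i. t i = u (i - 1) + d" and r: "r = 1" and d: "3 dvd d"
    and gap: "\<And>i. s \<le> i \<Longrightarrow> i < s + len \<Longrightarrow> u (i + 1) = u i + d"
    and i: "0 \<le> i" "i + 1 \<le> len"
  shows "\<phi> (u (s + i)) = \<phi> (u (s + i mod 2))" "\<phi> (u (s + i + 1)) = \<phi> (u (s + (i + 1) mod 2))"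
    "\<phi> (u (s + i + 1) + 1) = \<phi> (u (s + 1) + 1)" "\<phi> (u (s + i + 1) + 2) = \<phi> (u (s + 1) + 2)"
proof -
  have "\<phi> (u (s + i)) = \<phi> (u (s + i mod 2)) \<and> \<phi> (u (s + i + 1)) = \<phi> (u (s + (i + 1) mod 2)) \<and>
    \<phi> (u (s + i + 1) + 1) = \<phi> (u (s + 1) + 1) \<and> \<phi> (u (s + i + 1) + 2) = \<phi> (u (s + 1) + 2)"
    using i
  proof (induction i rule: int_ge_induct)
    case (step i)
    define a where "a = u (s + i)"
    have b: "u (s + i + 1) = a + d"
      using gap[of "s + i"] step.hyps step.prems by (simp add: a_def)
    have c: "u (s + i + 1 + 1) = a + d + d"
      using gap[of "s + i + 1"] b step.hyps step.prems by simp
    have prev: "u (s + i + 1 - 1) = a" by (simp add: a_def)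
    have e: "even (a + d - (a + d))" by simp
    note tr = colour_block_even[OF t r d prev b c e]
    have "\<phi> (a + d + d) = \<phi> a" using d by (intro tr(1)) auto
    moreover have "\<phi> (a + d + d + 1) = \<phi> (a + d + 1)" using d by (intro tr(2)) auto
    moreover have "\<phi> (a + d + d + 2) = \<phi> (a + d + 2)" using d by (intro tr(3)) auto
    moreover have "(i + 1 + 1) mod 2 = i mod 2" by presburger
    moreover have "s + (i + 1) + 1 = s + i + 1 + 1" "s + (i + 1) = s + i + 1" by simp_all
    ultimately show ?case using step by (simp only: a_def[symmetric] b c)
  qed simp
  then show "\<phi> (u (s + i)) = \<phi> (u (s + i mod 2))" "\<phi> (u (s + i + 1)) = \<phi> (u (s + (i + 1) mod 2))"
    "\<phi> (u (s + i + 1) + 1) = \<phi> (u (s + 1) + 1)" "\<phi> (u (s + i + 1) + 2) = \<phi> (u (s + 1) + 2)"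
    by blast+
qed

text \<open>
  For \<open>r = 1\<close> interlacing means that every gap is at most \<open>d\<close> and that two neighbouring gaps have a sum greater than
  \<open>d\<close>.  A full gap satisfies the second condition with any neighbour, so it has to be checked inside the list of
  short gaps, and across its ends only if there is no full gap at all.
\<close>

lemma hamiltonian_of_forward_gaps:
  fixes g :: "int \<Rightarrow> int" and xs :: "int list" and len :: nat
  assumes "n > 0" and "xs \<noteq> []" and d: "d > 0" and ne: "\<forall>x\<in>set xs. 0 < x \<and> x \<le> d"
    and adj: "\<forall>i. Suc i < length xs \<longrightarrow> d < xs ! i + xs ! Suc i"
    and wrap: "len = 0 \<Longrightarrow> d < last xs + hd xs"
    and sum: "sum_list xs + int len * d = int n"
    and c: "[d + 3 = c] (mod int n)"
    and conn: "\<And>u \<phi> x. u 0 = 0 \<Longrightarrow> (\<And>i. i < length xs \<Longrightarrow> u (int i + 1) = u (int i) + xs ! i) \<Longrightarrow>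
      (\<And>i. int (length xs) \<le> i \<Longrightarrow> i < int (length xs) + int len \<Longrightarrow> u (i + 1) = u i + d) \<Longrightarrow>
      interlacing_colouring n (int (length xs + len)) 1 d u (\<lambda>i. u (i - 1) + d) \<phi> \<Longrightarrow> \<phi> x = \<phi> 0"
  shows "hamiltonian (with_proj (circ n {2, 3, c}))"
proof -
  define k where "k = length xs + len"
  have k: "0 < int k" using assms(2) by (cases xs) (simp_all add: k_def)
  define G where "G h = (if h < length xs then xs ! h else d)" for h
  define g where "g i = G (nat (i mod int k))" for i
  have G_pos: "0 < G h \<and> G h \<le> d" for h
    using ne d by (auto simp: G_def)
  have G_adj: "d < G h + G (Suc h)" if "Suc h < k" for h
    using that adj ne d by (auto simp: G_def dest: nth_mem)
  have G_wrap: "d < G (k - 1) + G 0"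
  proof (cases "len = 0")
    case True
    then show ?thesis using wrap assms(2) by (simp add: G_def k_def hd_conv_nth last_conv_nth)
  next
    case False
    then have "\<not> k - 1 < length xs" unfolding k_def by linarith
    then have "G (k - 1) = d" by (simp add: G_def)
    then show ?thesis using G_pos[of 0] by simp
  qed
  show ?thesis
  proof (rule hamiltonian_of_gaps[where k = "int k" and r = 1 and d = d and g = g])
    show "g (i + int k) = g i" for i by (simp add: g_def)
    have "(\<Sum>i\<in>{0..<int k}. g i) = (\<Sum>h<k. G h)"
      by (rule sum.reindex_bij_witness[where i = int and j = nat]) (auto simp: g_def)
    also have "\<dots> = (\<Sum>h<length xs. xs ! h) + (\<Sum>h\<in>{length xs..<k}. d)"
    proof -
      have "{..<k} = {..<length xs} \<union> {length xs..<k}" by (auto simp: k_def)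
      then have "(\<Sum>h<k. G h) = (\<Sum>h<length xs. G h) + (\<Sum>h\<in>{length xs..<k}. G h)"
        by (simp add: sum.union_disjoint ivl_disj_int)
      then show ?thesis by (simp add: G_def)
    qed
    also have "\<dots> = int n" using sum by (simp add: sum_list_sum_nth atLeast0LessThan k_def)
    finally show "(\<Sum>i\<in>{0..<int k}. g i) = int n" .
    show "u i \<le> u (i - 1) + d \<and> u (i - 1) + d < u (i + 1)"
      if u: "\<And>i. u (i + 1) = u i + g i" for u i
    proof -
      have "d < g (i - 1) + g i"
      proof (cases "i mod int k = 0")
        case True
        then have "(i - 1) mod int k = int k - 1"
          using k by (metis diff_0 mod_diff_left_eq zmod_minus1)
        then show ?thesis using True G_wrap k by (simp add: g_def nat_diff_distrib)
      next
        case False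
        then have "0 < i mod int k" using pos_mod_sign[OF k, of i] by linarith
        moreover have lt: "i mod int k < int k" using k by simp
        ultimately have "(i - 1) mod int k = i mod int k - 1"
          using mod_diff_left_eq[of i "int k" 1] by simp
        moreover define h where "h = nat (i mod int k - 1)"
        ultimately have "g (i - 1) = G h" "g i = G (Suc h)" "Suc h < k"
          using \<open>0 < i mod int k\<close> lt by (simp_all add: g_def nat_diff_distrib)
        then show ?thesis using G_adj by simp
      qed
      then show ?thesis
        using u[of i] u[of "i - 1"] G_pos by (simp add: g_def)
    qed
  next
    fix u \<phi> x
    assume u: "u 0 = 0" "\<And>i. u (i + 1) = u i + g i"
      and col: "interlacing_colouring n (int k) 1 d u (\<lambda>i. u (i - 1) + d) \<phi>"
    show "\<phi> x = \<phi> 0"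
    proof (rule conn[where u = u and \<phi> = \<phi>, OF u(1)])
      show "u (int i + 1) = u (int i) + xs ! i" if "i < length xs" for i
        using u(2)[of "int i"] that by (simp add: g_def G_def k_def)
      show "u (i + 1) = u i + d" if "int (length xs) \<le> i" "i < int (length xs) + int len" for i
        using u(2)[of i] that by (simp add: g_def G_def k_def nat_less_iff)
    qed (use col in \<open>simp add: k_def\<close>)
  qed (use assms(1) k c in auto)
qed

lemma (in interlacing_colouring) run_of_full_gaps_constant:
  assumes t: "\<And>i. t i = u (i - 1) + d" and r: "r = 1" and d: "3 dvd d"
    and gap: "\<And>i. s \<le> i \<Longrightarrow> i < s + len \<Longrightarrow> u (i + 1) = u i + d"
    and start: "\<And>q. q \<in> {0, 1, 2} \<Longrightarrow> \<phi> (u s + q) = c \<and> \<phi> (u (s + 1) + q) = c"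
    and i: "s \<le> i" "i < s + len" and q: "q \<in> {0, 1, 2}"
  shows "\<phi> (u i + q) = c"
proof (cases "i = s")
  case True
  then show ?thesis using start[OF q] by simp
next
  case False
  define h where "h = i - s - 1"
  have h: "0 \<le> h" "h + 1 \<le> len" "i = s + h + 1" using i False by (simp_all add: h_def)
  note run = run_of_full_gaps[where s = s and len = len and i = h, OF t r d gap h(1,2)]
  have "(h + 1) mod 2 = 0 \<or> (h + 1) mod 2 = 1" by presburger
  then have "\<phi> (u i) = c"
    using run(2) start[of 0] h(3) by auto
  moreover have "\<phi> (u i + 1) = c" "\<phi> (u i + 2) = c"
    using run(3,4) start[of 1] start[of 2] h(3) by auto
  ultimately show ?thesis using q by auto
qed

text \<open>
  A run of positive even length therefore acts like a run of length 2, so one computation covers all of them.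
\<close>

lemma (in interlacing_colouring) run_of_full_gaps_end:
  assumes t: "\<And>i. t i = u (i - 1) + d" and r: "r = 1" and d: "3 dvd d"
    and gap: "\<And>i. s \<le> i \<Longrightarrow> i < s + 2 * w \<Longrightarrow> u (i + 1) = u i + d" and w: "0 < w"
  shows "\<phi> (u (s + 2 * w - 1)) = \<phi> (u (s + 1))" "\<phi> (u (s + 2 * w)) = \<phi> (u s)"
    "\<phi> (u (s + 2 * w) + 1) = \<phi> (u (s + 1) + 1)" "\<phi> (u (s + 2 * w) + 2) = \<phi> (u (s + 1) + 2)"
proof -
  have h: "0 \<le> 2 * w - 1" "(2 * w - 1) + 1 \<le> 2 * w" using w by simp_all
  note run = run_of_full_gaps[where s = s and len = "2 * w" and i = "2 * w - 1", OF t r d gap h]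
  have eqs: "(2 * w - 1) mod 2 = 1" "(2 * w - 1 + 1) mod 2 = 0"
    "s + (2 * w - 1) = s + 2 * w - 1" "s + 2 * w - 1 + 1 = s + 2 * w" "s + 0 = s"
    by presburger+
  from run show "\<phi> (u (s + 2 * w - 1)) = \<phi> (u (s + 1))" "\<phi> (u (s + 2 * w)) = \<phi> (u s)"
    "\<phi> (u (s + 2 * w) + 1) = \<phi> (u (s + 1) + 1)" "\<phi> (u (s + 2 * w) + 2) = \<phi> (u (s + 1) + 2)"
    by (simp_all only: eqs)
qed

text \<open>
  The short gaps are equal to 4 modulo 6.  Hence all blocks keep the order of their strands, the first positions
  \<open>0, u 1, u 2, u 3\<close> have residues 0, 1, 2, 0 modulo 3, and the four strands that cross a block boundary are permuted
  cyclically by one turn.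
\<close>

lemma hamiltonian_three_short_gaps:
  fixes d g1 g3 c :: int and w :: nat
  assumes d: "6 dvd d" "d > 0" and g: "g1 mod 6 = 4" "g3 mod 6 = 4" "0 < g1" "g1 < d" "0 < g3" "g3 < d"
    and wrap: "w = 0 \<Longrightarrow> d < g1 + g3"
    and n: "n > 0" "int n = g1 + g3 + d - 2 + 2 * int w * d"
    and c: "[d + 3 = c] (mod int n)"
  shows "hamiltonian (with_proj (circ n {2, 3, c}))"
proof (rule hamiltonian_of_forward_gaps[where xs = "[g1, d - 2, g3]" and len = "2 * w" and d = d])
  have "6 \<le> d" using d by (auto elim!: dvdE)
  moreover have "4 \<le> g1" "4 \<le> g3" using g by presburger+
  ultimately show "\<forall>x\<in>set [g1, d - 2, g3]. 0 < x \<and> x \<le> d"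
    and "\<forall>i. Suc i < length [g1, d - 2, g3] \<longrightarrow> d < [g1, d - 2, g3] ! i + [g1, d - 2, g3] ! Suc i"
    using g by (auto simp: less_Suc_eq nth_Cons')
next
  fix u \<phi> x
  assume u0: "u 0 = 0"
    and short: "\<And>i. i < length [g1, d - 2, g3] \<Longrightarrow> u (int i + 1) = u (int i) + [g1, d - 2, g3] ! i"
    and full: "\<And>i. int (length [g1, d - 2, g3]) \<le> i \<Longrightarrow> i < int (length [g1, d - 2, g3]) + int (2 * w) \<Longrightarrow>
      u (i + 1) = u i + d"
    and "interlacing_colouring n (int (length [g1, d - 2, g3] + 2 * w)) 1 d u (\<lambda>i. u (i - 1) + d) \<phi>"
  then interpret interlacing_colouring n "3 + 2 * int w" 1 d u "\<lambda>i. u (i - 1) + d" \<phi> by simp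
  define v2 where "v2 = g1 + d - 2"
  define v3 where "v3 = g1 + g3 + d - 2"
  define W where "W = int w"
  have u: "u 1 = g1" "u 2 = v2" "u 3 = v3"
    using short[of 0] short[of 1] short[of 2] u0 by (simp_all add: v2_def v3_def)
  have d3: "3 dvd d" using d(1) by presburger
  obtain d' where d': "d = 6 * d'" using d(1) by (elim dvdE)
  obtain a where a: "g1 = 6 * a + 4" using g(1) by (metis mult_div_mod_eq)
  obtain b where b: "g3 = 6 * b + 4" using g(2) by (metis mult_div_mod_eq)
  have n6: "int n = 6 * (a + b + d' + 1 + 2 * W * d')" using n(2) by (simp add: a b d' W_def algebra_simps)
  have uk: "u (3 + 2 * W) = int n" "u (3 + 2 * W + 1) = int n + g1"
    using u_periodic[of 0] u_periodic[of 1] u0 u(1) by (simp_all add: W_def add.commute add.left_commute)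
  have per: "\<phi> (int n + y) = \<phi> y" for y
    using colour_periodic[of y] by (simp add: add.commute)
  have per0: "\<phi> (int n) = \<phi> 0" using per[of 0] by simp
  have res: "g1 mod 3 = 1" "v2 mod 3 = 2" "v3 mod 3 = 0" "d mod 3 = 0" "int n mod 3 = 0"
    unfolding v2_def v3_def n6 unfolding a b d' by presburger+
  have par: "even g1" "even v2" "even v3" "even d"
    by (simp_all add: v2_def v3_def a b d')
  have at1: "u (1 - 1) = 0" "u 1 = g1" "u (1 + 1) = v2" "even (0 + d - g1)"
    and at2: "u (2 - 1) = g1" "u 2 = v2" "u (2 + 1) = v3" "even (g1 + d - v2)"
    and at3: "u (3 - 1) = v2" "u 3 = v3" "even (v2 + d - v3)"
    by (simp_all add: u u0 par)
  note tr1 = colour_block_even[OF refl refl d3 at1]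
  note tr2 = colour_block_even[OF refl refl d3 at2]
  have s1: "\<phi> v2 = \<phi> (g1 + 2)" "\<phi> (v2 + 1) = \<phi> 0" "\<phi> (v2 + 2) = \<phi> (g1 + 1)"
    by (rule tr1(3) tr1(1) tr1(2); use res in presburger)+
  have s2: "\<phi> v3 = \<phi> (v2 + 2)" "\<phi> (v3 + 1) = \<phi> g1" "\<phi> (v3 + 2) = \<phi> (v2 + 1)"
    by (rule tr2(3) tr2(1) tr2(2); use res in presburger)+
  show "\<phi> x = \<phi> 0"
  proof (cases "w = 0")
    case True
    then have k: "u (3 + 1) = int n + g1" "v3 = int n" using uk u by (simp_all add: W_def)
    note tr3 = colour_block_even[OF refl refl d3 at3(1,2) k(1) at3(3)]
    have "\<phi> (int n + g1) = \<phi> (v3 + 2)" "\<phi> (int n + (g1 + 1)) = \<phi> v2" "\<phi> (int n + (g1 + 2)) = \<phi> (v3 + 1)"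
      by (rule tr3(3) tr3(1) tr3(2); use res in presburger)+
    then have all: "\<phi> 1 = \<phi> 0" "\<phi> 2 = \<phi> 0" "\<phi> g1 = \<phi> 0" "\<phi> (g1 + 1) = \<phi> 0" "\<phi> (g1 + 2) = \<phi> 0"
      "\<phi> v2 = \<phi> 0" "\<phi> (v2 + 1) = \<phi> 0" "\<phi> (v2 + 2) = \<phi> 0"
      using s1 s2 unfolding k per per0 by argo+
    show ?thesis
    proof (rule colour_window)
      fix i q :: int
      assume "0 \<le> i" "i < 3 + 2 * int w" "q \<in> {0, 1, 2}"
      then have "(i = 0 \<or> i = 1 \<or> i = 2) \<and> (q = 0 \<or> q = 1 \<or> q = 2)" using True by auto
      then show "\<phi> (u i + q) = \<phi> 0" using all u u0 by auto
    qed simp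
  next
    case False
    then have W: "0 < W" by (simp add: W_def)
    have full': "u (i + 1) = u i + d" if "3 \<le> i" "i < 3 + 2 * W" for i
      using full that by (simp add: W_def)
    have u4: "u (3 + 1) = v3 + d" using full'[of 3] W u by simp
    have pred: "u (3 + 2 * W - 1) = int n - d" using full'[of "3 + 2 * W - 1"] W uk by simp
    note tr3 = colour_block_even[OF refl refl d3 at3(1,2) u4 at3(3)]
    have s3: "\<phi> (v3 + d) = \<phi> (v3 + 1)" "\<phi> (v3 + d + 1) = \<phi> (v3 + 2)" "\<phi> (v3 + d + 2) = \<phi> v2"
      by (rule tr3(2) tr3(3) tr3(1); use res in presburger)+
    have "even (int n - d + d - int n)" by simp
    note trk = colour_block_even[OF refl refl d3 pred uk this]
    have sk: "\<phi> (int n + g1) = \<phi> (int n + 1)" "\<phi> (int n + (g1 + 1)) = \<phi> (int n + 2)"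
        "\<phi> (int n + (g1 + 2)) = \<phi> (int n - d)"
      by (rule trk(2) trk(3) trk(1); use res in presburger)+
    note run = run_of_full_gaps_end[where s = 3 and w = W, OF refl refl d3 full' W]
    have "\<phi> (int n - d) = \<phi> (v3 + d)" "\<phi> (int n) = \<phi> v3" "\<phi> (int n + 1) = \<phi> (v3 + d + 1)"
      "\<phi> (int n + 2) = \<phi> (v3 + d + 2)"
      using run by (simp_all only: pred uk u u4)
    then have all: "\<phi> 1 = \<phi> 0" "\<phi> 2 = \<phi> 0" "\<phi> g1 = \<phi> 0" "\<phi> (g1 + 1) = \<phi> 0" "\<phi> (g1 + 2) = \<phi> 0"
      "\<phi> v2 = \<phi> 0" "\<phi> (v2 + 1) = \<phi> 0" "\<phi> (v2 + 2) = \<phi> 0" "\<phi> v3 = \<phi> 0" "\<phi> (v3 + 1) = \<phi> 0"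
      "\<phi> (v3 + 2) = \<phi> 0" "\<phi> (v3 + d) = \<phi> 0" "\<phi> (v3 + d + 1) = \<phi> 0" "\<phi> (v3 + d + 2) = \<phi> 0"
      using s1 s2 s3 sk unfolding per per0 by argo+
    show ?thesis
    proof (rule colour_window)
      fix i q :: int
      assume i: "0 \<le> i" "i < 3 + 2 * int w" and q: "q \<in> {0, 1, 2}"
      show "\<phi> (u i + q) = \<phi> 0"
      proof (cases "3 \<le> i")
        case True
        show ?thesis
        proof (rule run_of_full_gaps_constant[where s = 3 and len = "2 * W", OF refl refl d3 full' _ True _ q])
          show "\<phi> (u 3 + q) = \<phi> 0 \<and> \<phi> (u (3 + 1) + q) = \<phi> 0" if "q \<in> {0, 1, 2}" for q
            using that all u4[simplified] by (auto simp: u)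
        qed (use i in \<open>simp_all add: W_def\<close>)
      next
        case False
        then have "(i = 0 \<or> i = 1 \<or> i = 2) \<and> (q = 0 \<or> q = 1 \<or> q = 2)" using i q by auto
        then show ?thesis using all u u0 by auto
      qed
    qed simp
  qed
qed (use assms in auto)

text \<open>
  Three short gaps equal to 4 modulo 6 cannot have a sum that is an odd multiple of \<open>d\<close>: a sum \<open>d\<close> is excluded by the
  interlacing and a sum \<open>3 d\<close> by the gaps being short.  This is the replacement if \<open>n\<close> is an odd multiple of \<open>d\<close>.  Here
  the gaps 3 swap the strands of the blocks that follow them.
\<close>

lemma hamiltonian_five_short_gaps:
  fixes d c :: int and w :: nat
  assumes d: "6 dvd d" "d > 0" and n: "n > 0" "int n = 3 * d + 2 * int w * d"
    and c: "[d + 3 = c] (mod int n)"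
  shows "hamiltonian (with_proj (circ n {2, 3, c}))"
proof (rule hamiltonian_of_forward_gaps[where xs = "[3, d - 2, 3, d - 2, d - 2]" and len = "2 * w" and d = d])
  have "6 \<le> d" using d by (auto elim!: dvdE)
  then show "\<forall>x\<in>set [3, d - 2, 3, d - 2, d - 2]. 0 < x \<and> x \<le> d"
    and "\<forall>i. Suc i < length [3, d - 2, 3, d - 2, d - 2] \<longrightarrow>
      d < [3, d - 2, 3, d - 2, d - 2] ! i + [3, d - 2, 3, d - 2, d - 2] ! Suc i"
    by (auto simp: less_Suc_eq nth_Cons')
next
  let ?xs = "[3, d - 2, 3, d - 2, d - 2]"
  fix u \<phi> x
  assume u0: "u 0 = 0"
    and short: "\<And>i. i < length ?xs \<Longrightarrow> u (int i + 1) = u (int i) + ?xs ! i"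
    and full: "\<And>i. int (length ?xs) \<le> i \<Longrightarrow> i < int (length ?xs) + int (2 * w) \<Longrightarrow>
      u (i + 1) = u i + d"
    and "interlacing_colouring n (int (length ?xs + 2 * w)) 1 d u (\<lambda>i. u (i - 1) + d) \<phi>"
  then interpret interlacing_colouring n "5 + 2 * int w" 1 d u "\<lambda>i. u (i - 1) + d" \<phi> by simp
  define W where "W = int w"
  have u: "u 1 = 3" "u 2 = d + 1" "u 3 = d + 4" "u 4 = 2 * d + 2" "u 5 = 3 * d"
    using short[of 0] short[of 1] short[of 2] short[of 3] short[of 4] u0 by simp_all
  have d3: "3 dvd d" and d2: "even d" using d(1) by presburger+
  have "3 dvd int n" unfolding n(2) using d3 by simp
  then have res: "d mod 3 = 0" "int n mod 3 = 0" using d3 by presburger+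
  have uk: "u (5 + 2 * W) = int n" "u (5 + 2 * W + 1) = int n + 3"
    using u_periodic[of 0] u_periodic[of 1] u0 u(1) by (simp_all add: W_def add.commute add.left_commute)
  have per: "\<phi> (int n + y) = \<phi> y" for y
    using colour_periodic[of y] by (simp add: add.commute)
  have per0: "\<phi> (int n) = \<phi> 0" using per[of 0] by simp
  have at1: "u (1 - 1) = 0" "u 1 = 3" "u (1 + 1) = d + 1" "odd (0 + d - 3)"
    and at2: "u (2 - 1) = 3" "u 2 = d + 1" "u (2 + 1) = d + 4" "even (3 + d - (d + 1))"
    and at3: "u (3 - 1) = d + 1" "u 3 = d + 4" "u (3 + 1) = 2 * d + 2" "odd (d + 1 + d - (d + 4))"
    and at4: "u (4 - 1) = d + 4" "u 4 = 2 * d + 2" "u (4 + 1) = 3 * d" "even (d + 4 + d - (2 * d + 2))"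
    and at5: "u (5 - 1) = 2 * d + 2" "u 5 = 3 * d" "even (2 * d + 2 + d - 3 * d)"
    using d2 by (simp_all add: u u0)
  note tr1 = colour_block_odd[OF refl refl d3 at1]
  note tr2 = colour_block_even[OF refl refl d3 at2]
  note tr3 = colour_block_odd[OF refl refl d3 at3]
  note tr4 = colour_block_even[OF refl refl d3 at4]
  have s1: "\<phi> (d + 1) = \<phi> (3 + 2)" "\<phi> (d + 2) = \<phi> (3 + 1)" "\<phi> (d + 3) = \<phi> 0"
    by (rule tr1(2) tr1(3) tr1(1); use res in presburger)+
  have s2: "\<phi> (d + 4) = \<phi> (d + 1 + 1)" "\<phi> (d + 5) = \<phi> (d + 1 + 2)" "\<phi> (d + 6) = \<phi> 3"
    by (rule tr2(2) tr2(3) tr2(1); use res in presburger)+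
  have s3: "\<phi> (2 * d + 2) = \<phi> (d + 4 + 2)" "\<phi> (2 * d + 3) = \<phi> (d + 4 + 1)" "\<phi> (2 * d + 4) = \<phi> (d + 1)"
    by (rule tr3(2) tr3(3) tr3(1); use res in presburger)+
  have s4: "\<phi> (3 * d) = \<phi> (2 * d + 2 + 2)" "\<phi> (3 * d + 1) = \<phi> (d + 4)" "\<phi> (3 * d + 2) = \<phi> (2 * d + 2 + 1)"
    by (rule tr4(3) tr4(1) tr4(2); use res in presburger)+
  have assoc: "d + 1 + 1 = d + 2" "d + 1 + 2 = d + 3" "d + 4 + 1 = d + 5" "d + 4 + 2 = d + 6"
    "2 * d + 2 + 1 = 2 * d + 3" "2 * d + 2 + 2 = 2 * d + 4" "3 + 1 = (4 :: int)" "3 + 2 = (5 :: int)"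
    by simp_all
  show "\<phi> x = \<phi> 0"
  proof (cases "w = 0")
    case True
    then have k: "u (5 + 1) = int n + 3" "3 * d = int n" using uk n(2) by (simp_all add: W_def)
    note tr5 = colour_block_even[OF refl refl d3 at5(1,2) k(1) at5(3)]
    have s5: "\<phi> (int n + 3) = \<phi> (3 * d + 1)" "\<phi> (int n + 4) = \<phi> (3 * d + 2)" "\<phi> (int n + 5) = \<phi> (2 * d + 2)"
      by (rule tr5(2) tr5(3) tr5(1); use res in presburger)+
    have all: "\<phi> 1 = \<phi> 0" "\<phi> 2 = \<phi> 0" "\<phi> 3 = \<phi> 0" "\<phi> 4 = \<phi> 0" "\<phi> 5 = \<phi> 0"
      "\<phi> (d + 1) = \<phi> 0" "\<phi> (d + 2) = \<phi> 0" "\<phi> (d + 3) = \<phi> 0" "\<phi> (d + 4) = \<phi> 0" "\<phi> (d + 5) = \<phi> 0"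
      "\<phi> (d + 6) = \<phi> 0" "\<phi> (2 * d + 2) = \<phi> 0" "\<phi> (2 * d + 3) = \<phi> 0" "\<phi> (2 * d + 4) = \<phi> 0"
      using s1 s2 s3 s4 s5 unfolding k(2) per per0 assoc by argo+
    show ?thesis
    proof (rule colour_window)
      fix i q :: int
      assume "0 \<le> i" "i < 5 + 2 * int w" "q \<in> {0, 1, 2}"
      then have "(i = 0 \<or> i = 1 \<or> i = 2 \<or> i = 3 \<or> i = 4) \<and> (q = 0 \<or> q = 1 \<or> q = 2)"
        using True by auto
      then show "\<phi> (u i + q) = \<phi> 0" using all u u0 by (auto simp: add.commute)
    qed simp
  next
    case False
    then have W: "0 < W" by (simp add: W_def)
    have full': "u (i + 1) = u i + d" if "5 \<le> i" "i < 5 + 2 * W" for i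
      using full that by (simp add: W_def)
    have u6: "u (5 + 1) = 4 * d" using full'[of 5] W u by simp
    have pred: "u (5 + 2 * W - 1) = int n - d" using full'[of "5 + 2 * W - 1"] W uk by simp
    note tr5 = colour_block_even[OF refl refl d3 at5(1,2) u6 at5(3)]
    have s5: "\<phi> (4 * d) = \<phi> (3 * d + 1)" "\<phi> (4 * d + 1) = \<phi> (3 * d + 2)" "\<phi> (4 * d + 2) = \<phi> (2 * d + 2)"
      by (rule tr5(2) tr5(3) tr5(1); use res in presburger)+
    have "even (int n - d + d - int n)" by simp
    note trk = colour_block_even[OF refl refl d3 pred uk this]
    have sk: "\<phi> (int n + 3) = \<phi> (int n - d)" "\<phi> (int n + 4) = \<phi> (int n + 1)"
        "\<phi> (int n + 5) = \<phi> (int n + 2)"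
      by (rule trk(1) trk(2) trk(3); use res in presburger)+
    note run = run_of_full_gaps_end[where s = 5 and w = W, OF refl refl d3 full' W]
    have run': "\<phi> (int n - d) = \<phi> (4 * d)" "\<phi> (int n) = \<phi> (3 * d)" "\<phi> (int n + 1) = \<phi> (4 * d + 1)"
      "\<phi> (int n + 2) = \<phi> (4 * d + 2)"
      using run by (simp_all only: pred uk u u6)
    have all: "\<phi> 1 = \<phi> 0" "\<phi> 2 = \<phi> 0" "\<phi> 3 = \<phi> 0" "\<phi> 4 = \<phi> 0" "\<phi> 5 = \<phi> 0"
      "\<phi> (d + 1) = \<phi> 0" "\<phi> (d + 2) = \<phi> 0" "\<phi> (d + 3) = \<phi> 0" "\<phi> (d + 4) = \<phi> 0" "\<phi> (d + 5) = \<phi> 0"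
      "\<phi> (d + 6) = \<phi> 0" "\<phi> (2 * d + 2) = \<phi> 0" "\<phi> (2 * d + 3) = \<phi> 0" "\<phi> (2 * d + 4) = \<phi> 0"
      "\<phi> (3 * d) = \<phi> 0" "\<phi> (3 * d + 1) = \<phi> 0" "\<phi> (3 * d + 2) = \<phi> 0"
      "\<phi> (4 * d) = \<phi> 0" "\<phi> (4 * d + 1) = \<phi> 0" "\<phi> (4 * d + 2) = \<phi> 0"
      using s1 s2 s3 s4 s5 sk run' unfolding per per0 assoc by argo+
    show ?thesis
    proof (rule colour_window)
      fix i q :: int
      assume i: "0 \<le> i" "i < 5 + 2 * int w" and q: "q \<in> {0, 1, 2}"
      show "\<phi> (u i + q) = \<phi> 0"
      proof (cases "5 \<le> i")
        case True
        show ?thesis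
        proof (rule run_of_full_gaps_constant[where s = 5 and len = "2 * W", OF refl refl d3 full' _ True _ q])
          show "\<phi> (u 5 + q) = \<phi> 0 \<and> \<phi> (u (5 + 1) + q) = \<phi> 0" if "q \<in> {0, 1, 2}" for q
            using that all u6[simplified] by (auto simp: u)
        qed (use i in \<open>simp_all add: W_def\<close>)
      next
        case False
        then have "(i = 0 \<or> i = 1 \<or> i = 2 \<or> i = 3 \<or> i = 4) \<and> (q = 0 \<or> q = 1 \<or> q = 2)" using i q by auto
        then show ?thesis using all u u0 by (auto simp: add.commute)
      qed
    qed simp
  qed
qed (use assms in auto)

lemma hamiltonian_forward_jump:
  fixes d c :: int and m :: nat
  assumes d: "6 dvd d" "0 < d" "d \<le> 3 * int m" and c: "[d + 3 = c] (mod int (6 * m))"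
  shows "hamiltonian (with_proj (circ (6 * m) {2, 3, c}))"
proof -
  define n where "n = 6 * m"
  have n: "0 < n" "2 * d \<le> int n" "6 dvd int n" using d by (auto simp: n_def)
  \<comment> \<open>\<open>n = (2 w + 1) d + rho\<close>; the three short gaps replace \<open>d + rho\<close> and leave \<open>2 w\<close> full ones\<close>
  define w where "w = nat ((int n - d) div (2 * d))"
  define rho where "rho = (int n - d) mod (2 * d)"
  have "0 \<le> (int n - d) div (2 * d)" using d(2) n(2) by (simp add: pos_imp_zdiv_nonneg_iff)
  then have w: "int w = (int n - d) div (2 * d)" by (simp add: w_def)
  have split: "int n - d = 2 * d * int w + rho" unfolding w rho_def by simp
  have rho: "0 \<le> rho" "rho < 2 * d" using d(2) by (simp_all add: rho_def)
  have rho6: "6 dvd rho"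
  proof -
    have "rho = int n - d - 2 * d * int w" using split by simp
    then show ?thesis using n(3) d(1) by simp
  qed
  show ?thesis
  proof (cases "rho = 0")
    case True
    have "w \<noteq> 0"
    proof
      assume "w = 0"
      then have "int n = d" using split True by simp
      then show False using n(2) d(2) by simp
    qed
    have "int n = 3 * d + 2 * int (w - 1) * d"
      using split True \<open>w \<noteq> 0\<close> by (simp add: of_nat_diff algebra_simps)
    from hamiltonian_five_short_gaps[OF d(1,2) n(1) this] c show ?thesis by (simp add: n_def)
  next
    case False
    have "6 \<le> rho" using rho(1) rho6 False by presburger
    \<comment> \<open>the middle gap is \<open>d - 2\<close>, so the outer two have the sum \<open>rho + 2\<close>, and one of them is as long as possible\<close>
    define g1 where "g1 = min (d - 2) (rho - 2)"
    define g3 where "g3 = rho + 2 - g1"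
    have d6: "6 \<le> d" using d(1,2) by presburger
    have "rho mod 6 = 0" "d mod 6 = 0" using rho6 d(1) by presburger+
    then have "(d - 2) mod 6 = 4" "(rho - 2) mod 6 = 4" "(rho + 2 - (d - 2)) mod 6 = 4"
      "(rho + 2 - (rho - 2)) mod 6 = 4" by presburger+
    then have mods: "g1 mod 6 = 4" "g3 mod 6 = 4"
      by (simp_all only: g3_def g1_def min_def split: if_split) simp_all
    have "rho \<le> 2 * d - 6" using rho(2) rho6 d(1) by presburger
    then have bounds: "0 < g1" "g1 < d" "0 < g3" "g3 < d"
      using \<open>6 \<le> rho\<close> d6 by (simp_all add: g3_def g1_def min_def split: if_split)
    have wrap: "d < g1 + g3" if "w = 0"
      using split that n(2) by (simp add: g3_def)
    have "int n = g1 + g3 + d - 2 + 2 * int w * d"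
      using split by (simp add: g3_def algebra_simps)
    from hamiltonian_three_short_gaps[OF d(1,2) mods bounds wrap n(1) this] c
    show ?thesis by (simp add: n_def)
  qed
qed

section \<open>The parity obstruction\<close>

lemma cycle_of_list_nth:
  assumes "distinct cs" "i < length cs"
  shows "cycle_of_list cs (cs ! i) = cs ! (Suc i mod length cs)"
proof -
  have "map (cycle_of_list cs) cs = rotate1 cs"
    using cyclic_rotation[OF assms(1), of 1] by simp
  then have "map (cycle_of_list cs) cs ! i = rotate1 cs ! i" by simp
  then show ?thesis using assms(2) by (simp add: nth_rotate1)
qed

lemma eq_cycle_of_listI:
  assumes "distinct cs" and "\<And>i. i < length cs \<Longrightarrow> f (cs ! i) = cs ! (Suc i mod length cs)"
    and "\<And>x. x \<notin> set cs \<Longrightarrow> f x = x"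
  shows "f = cycle_of_list cs"
proof
  fix x
  show "f x = cycle_of_list cs x"
  proof (cases "x \<in> set cs")
    case True
    then obtain i where "i < length cs" "x = cs ! i" by (metis in_set_conv_nth)
    then show ?thesis using assms(2) cycle_of_list_nth[OF assms(1)] by simp
  next
    case False
    then show ?thesis using assms(3)[OF False] id_outside_supp[OF False] by simp
  qed
qed

lemma sign_cycle_of_list:
  assumes "distinct cs" "cs \<noteq> []"
  shows "sign (cycle_of_list cs) = (- 1) ^ (length cs - 1)"
  using assms
proof (induction cs rule: cycle_of_list.induct)
  case (1 i j cs)
  then have "i \<noteq> j" by auto
  have "sign (transpose i j \<circ> cycle_of_list (j # cs)) =
      sign (transpose i j) * sign (cycle_of_list (j # cs))"
    by (intro sign_compose permutation_swap_id permutation_of_cycle)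
  then show ?case using 1 \<open>i \<noteq> j\<close> by (simp add: sign_swap_id comp_def)
qed (simp_all add: id_def[symmetric])

text \<open>
  Let the arcs have lengths \<open>a\<close>, \<open>b\<close> and \<open>b + k\<close> modulo \<open>n = 2 k\<close>, and let \<open>h\<close> be the successor function of a
  hamiltonian cycle.  Undo the translation \<open>T\<close> by \<open>a\<close>: the permutation \<open>\<rho> = inv T \<circ> h\<close> fixes all vertices that leave by \<open>a\<close>
  and moves the set \<open>B\<close> of the other vertices by \<open>b - a = 1\<close> or \<open>-1\<close> modulo \<open>k\<close>.  So all fibres of the reduction modulo \<open>k\<close>
  contain equally many elements of \<open>B\<close>.  If there are none, all arcs have length \<open>a\<close> and preserve divisibility by \<open>a\<close>;
  if there are two, all arcs preserve divisibility by \<open>b\<close>.  If there is one, then \<open>\<rho>\<close> is a cycle of length \<open>k\<close>.  As \<open>h\<close>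
  and the translation by 1 are cycles of even length \<open>n\<close>, comparing signs gives \<open>-1 = (-1)^a (-1)^(k - 1)\<close>, against
  the parity hypothesis.
\<close>

lemma not_hamiltonian_half_shift:
  fixes k :: nat and a b :: int
  assumes ab: "(a, b) = (3, 2) \<or> (a, b) = (2, 3)" and k: "k > 1"
    and a_dvd: "a dvd 2 * int k" and b_dvd: "b dvd int k" and par: "odd (a + int k)"
    and S: "\<And>s. s \<in> S \<Longrightarrow> [s = a] (mod 2 * int k) \<or> [s = b] (mod 2 * int k) \<or> [s = b + int k] (mod 2 * int k)"
  shows "\<not> hamiltonian (with_proj (circ (2 * k) S))"
proof
  define K where "K = int k"
  define n where "n = 2 * K"
  define V where "V = {0..<n}"
  have K: "1 < K" "0 < n" using k by (simp_all add: K_def n_def)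
  assume "hamiltonian (with_proj (circ (2 * k) S))"
  then obtain vs where dist: "distinct vs" and set: "set vs = V"
    and step: "\<And>i. i < 2 * k \<Longrightarrow> \<exists>s\<in>S. vs ! (Suc i mod (2 * k)) = (vs ! i + s) mod n"
    using k by (auto simp: hamiltonian_circ_iff V_def n_def K_def)
  have len: "length vs = 2 * k" using distinct_card[OF dist] set by (simp add: V_def n_def K_def)
  define h where "h = cycle_of_list vs"
  have h_perm: "permutation h" "h permutes V"
    using permutation_of_cycle cycle_permutes set unfolding h_def by metis+
  have "vs \<noteq> []" "odd (2 * k - 1)" using len k by auto
  then have sign_h: "sign h = - 1"
    using sign_cycle_of_list[OF dist] len unfolding h_def by (simp add: uminus_power_if)
  have h_nth: "h (vs ! i) = vs ! (Suc i mod (2 * k))" if "i < 2 * k" for i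
    using cycle_of_list_nth[OF dist, of i] that len by (simp add: h_def)
  have index: "\<exists>i<2 * k. vs ! i = v" if "v \<in> V" for v
    using that unfolding set[symmetric] in_set_conv_nth len by blast
  have h_arc: "h v = (v + a) mod n \<or> h v = (v + b) mod n \<or> h v = (v + b + K) mod n" if v: "v \<in> V" for v
  proof -
    obtain i where i: "i < 2 * k" "v = vs ! i"
      using index[OF v] by blast
    obtain s where s: "s \<in> S" "h v = (v + s) mod n"
      using step[OF i(1)] h_nth[OF i(1)] i(2) by auto
    have "[v + s = v + a] (mod n) \<or> [v + s = v + b] (mod n) \<or> [v + s = v + (b + K)] (mod n)"
      using S[OF s(1)] unfolding K_def n_def by (meson cong_add cong_refl)
    then show ?thesis using s(2) by (simp add: cong_def add.assoc)
  qed
  \<comment> \<open>a property that is kept along the cycle and holds at 0 holds everywhere\<close>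
  have invariant: "P v" if "P 0" and closed: "\<And>v. v \<in> V \<Longrightarrow> P v \<Longrightarrow> P (h v)" and "v \<in> V" for P v
  proof -
    have "0 \<in> V" using K by (simp add: V_def)
    then obtain i where i: "i < 2 * k" "vs ! i = 0" using index by blast
    have reach: "P (vs ! ((i + t) mod (2 * k)))" for t
    proof (induction t)
      case 0
      then show ?case using i \<open>P 0\<close> by simp
    next
      case (Suc t)
      define l where "l = (i + t) mod (2 * k)"
      have "l < 2 * k" using k by (simp add: l_def)
      then have "P (vs ! (Suc l mod (2 * k)))"
        using closed[of "vs ! l"] Suc set len nth_mem[of l vs] h_nth[of l] by (simp add: l_def)
      moreover have "Suc l mod (2 * k) = (i + Suc t) mod (2 * k)"
        by (simp add: l_def mod_Suc_eq)
      ultimately show ?case by simp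
    qed
    obtain l where l: "l < 2 * k" "v = vs ! l" using index[OF \<open>v \<in> V\<close>] by blast
    have "(i + (l + 2 * k - i)) mod (2 * k) = l" using i(1) l(1) by simp
    then show ?thesis using reach[of "l + 2 * k - i"] l(2) by simp
  qed
  have one: "1 \<in> V" using K by (simp add: V_def n_def)
  \<comment> \<open>the sign of \<open>T\<close> comes from writing it as a power of the \<open>n\<close>-cycle \<open>T1\<close>\<close>
  define T1 where "T1 x = (if x \<in> V then (x + 1) mod n else x)" for x
  define T where "T x = (if x \<in> V then (x + a) mod n else x)" for x
  have V_mod: "x mod n \<in> V" for x using K by (simp add: V_def)
  define zs where "zs = map int [0..<2 * k]"
  have zs: "distinct zs" "set zs = V" "length zs = 2 * k"
    by (auto simp: zs_def distinct_map V_def n_def K_def image_int_atLeastLessThan)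
  have "T1 = cycle_of_list zs"
  proof (rule eq_cycle_of_listI[OF zs(1)])
    show "T1 (zs ! i) = zs ! (Suc i mod length zs)" if "i < length zs" for i
      using that zs by (simp add: T1_def zs_def V_def n_def K_def zmod_int add.commute)
    show "T1 x = x" if "x \<notin> set zs" for x using that zs by (simp add: T1_def)
  qed
  then have T1_perm: "permutation T1" and sign_T1: "sign T1 = - 1"
    using permutation_of_cycle sign_cycle_of_list[OF zs(1)] zs(3) k
    by (auto simp: uminus_power_if zs_def)
  have T2: "T1 (T1 x) = (if x \<in> V then (x + 2) mod n else x)" for x
    using V_mod by (simp add: T1_def mod_add_left_eq add.assoc)
  then have T3: "T1 (T1 (T1 x)) = (if x \<in> V then (x + 3) mod n else x)" for x
    using V_mod by (auto simp: T1_def mod_add_right_eq mod_add_left_eq add.assoc)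
  have T_eq: "T = (if a = 2 then T1 \<circ> T1 else T1 \<circ> (T1 \<circ> T1))"
    using ab T2 T3 by (auto simp: T_def fun_eq_iff)
  have T_perm: "permutation T"
    unfolding T_eq by (simp add: T1_perm permutation_compose)
  have sign_T: "sign T = (if a = 2 then 1 else - 1)"
    unfolding T_eq by (simp add: sign_compose T1_perm permutation_compose sign_T1)
  have bij_T: "bij T" and bij_h: "bij h" using T_perm h_perm permutation_bijective by auto
  define \<rho> where "\<rho> = inv T \<circ> h"
  have \<rho>_perm: "permutation \<rho>"
    unfolding \<rho>_def by (intro permutation_compose permutation_inverse T_perm h_perm)
  have sign_\<rho>: "sign \<rho> = - sign T"
    unfolding \<rho>_def using sign_compose[OF permutation_inverse[OF T_perm] h_perm(1)]
    by (simp add: sign_inverse T_perm sign_h)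
  have T_\<rho>: "T (\<rho> x) = h x" for x
    using bij_T by (simp add: \<rho>_def bij_is_surj surj_f_inv_f)
  have inj_\<rho>: "inj \<rho>" using \<rho>_perm permutation_bijective bij_is_inj by blast
  have \<rho>_V: "\<rho> x \<in> V" if "x \<in> V" for x
  proof (rule ccontr)
    assume "\<rho> x \<notin> V"
    then have "h x = \<rho> x" using T_\<rho>[of x] by (simp add: T_def)
    then show False using permutes_in_image[OF h_perm(2)] that \<open>\<rho> x \<notin> V\<close> by metis
  qed
  define B where "B = {v \<in> V. h v \<noteq> T v}"
  have \<rho>_fix: "\<rho> x = x" if "x \<notin> B" for x
  proof -
    have "h x = T x"
      using that permutes_not_in[OF h_perm(2)] by (cases "x \<in> V") (auto simp: B_def T_def)
    then show ?thesis using T_\<rho>[of x] bij_T by (simp add: bij_is_inj inj_eq)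
  qed
  \<comment> \<open>an injective map that fixes everything outside \<open>B\<close> keeps \<open>B\<close> inside itself\<close>
  have \<rho>_B: "\<rho> x \<in> B" if "x \<in> B" for x
  proof (rule ccontr)
    assume "\<rho> x \<notin> B"
    then have "\<rho> (\<rho> x) = \<rho> x" by (rule \<rho>_fix)
    then have "\<rho> x = x" using inj_\<rho> by (simp add: inj_eq)
    then show False using that \<open>\<rho> x \<notin> B\<close> by simp
  qed
  define \<delta> where "\<delta> = b - a"
  have n_K: "(x mod n) mod K = x mod K" for x
    by (simp add: n_def mod_mod_cancel)
  have \<rho>_fibre: "\<rho> x mod K = (x + \<delta>) mod K" if "x \<in> B" for x
  proof -
    have xV: "x \<in> V" using that by (simp add: B_def)
    have "h x = (x + b) mod n \<or> h x = (x + b + K) mod n"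
      using h_arc[OF xV] that by (auto simp: B_def T_def)
    then have "h x mod K = (x + b) mod K" by (auto simp: n_K)
    moreover have "(\<rho> x + a) mod n = h x"
      using T_\<rho>[of x] \<rho>_V[OF xV] by (simp add: T_def)
    then have "h x mod K = (\<rho> x + a) mod K"
      using n_K[of "\<rho> x + a"] by simp
    ultimately have "[\<rho> x + a = (x + \<delta>) + a] (mod K)" by (simp add: cong_def \<delta>_def)
    then have "[\<rho> x = x + \<delta>] (mod K)" by (simp only: cong_add_rcancel)
    then show ?thesis by (simp only: cong_def)
  qed
  define \<beta> where "\<beta> f = {v \<in> B. v mod K = f mod K}" for f
  have fin: "finite (\<beta> f)" for f by (rule finite_subset[of _ V]) (auto simp: \<beta>_def B_def V_def)
  have "card (\<beta> f) \<le> card (\<beta> (f + \<delta>))" for f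
  proof (rule card_inj_on_le)
    show "inj_on \<rho> (\<beta> f)" using inj_\<rho> inj_on_subset by blast
    show "\<rho> ` \<beta> f \<subseteq> \<beta> (f + \<delta>)"
    proof
      fix y assume "y \<in> \<rho> ` \<beta> f"
      then obtain x where x: "x \<in> B" "x mod K = f mod K" "y = \<rho> x" by (auto simp: \<beta>_def)
      then have "y mod K = (f + \<delta>) mod K"
        using \<rho>_fibre[OF x(1)] mod_add_cong[OF x(2), of \<delta> \<delta>] by simp
      then show "y \<in> \<beta> (f + \<delta>)" using x \<rho>_B by (simp add: \<beta>_def)
    qed
  qed (rule fin)
  then have mono: "card (\<beta> f) \<le> card (\<beta> (f + int t * \<delta>))" for f t
  proof (induction t)
    case (Suc t)
    then show ?case using order_trans[OF Suc.IH[OF Suc.prems] Suc.prems[of "f + int t * \<delta>"]]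
      by (simp add: algebra_simps)
  qed simp
  have \<delta>: "\<delta> = 1 \<or> \<delta> = - 1" using ab by (auto simp: \<delta>_def)
  have ex_shift: "\<exists>t<k. (f + int t * \<delta>) mod K = g mod K" for f g
  proof (intro exI conjI)
    define t where "t = nat (((g - f) * \<delta>) mod K)"
    have t: "int t = ((g - f) * \<delta>) mod K" using K by (simp add: t_def)
    then show "t < k" using K K_def by (metis of_nat_less_iff pos_mod_bound less_trans zero_less_one)
    have "(f + int t * \<delta>) mod K = (f + (g - f) * \<delta> * \<delta>) mod K"
      unfolding t by (metis mod_add_right_eq mod_mult_left_eq)
    then show "(f + int t * \<delta>) mod K = g mod K" using \<delta> by auto
  qed
  have \<beta>_cong: "\<beta> f = \<beta> g" if "f mod K = g mod K" for f g using that by (simp add: \<beta>_def)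
  \<comment> \<open>the cardinalities increase weakly along a closed tour of all fibres\<close>
  have same: "card (\<beta> f) = card (\<beta> g)" for f g
    using ex_shift[of f g] ex_shift[of g f] mono \<beta>_cong by (metis le_antisym)
  have representative: "v = v mod K \<or> v = v mod K + K" if "v \<in> V" for v
  proof (cases "v < K")
    case False
    then have "(v - K) mod K = v - K"
      using that by (intro mod_pos_pos_trivial) (auto simp: V_def n_def)
    then show ?thesis by simp
  qed (use that in \<open>simp add: V_def\<close>)
  have fibre: "\<beta> f \<subseteq> {f mod K, f mod K + K}" for f
  proof
    fix v assume "v \<in> \<beta> f"
    then have "v \<in> V" "v mod K = f mod K" by (auto simp: \<beta>_def B_def)
    then show "v \<in> {f mod K, f mod K + K}" using representative[of v] by simp
  qed
  have "card (\<beta> 0) \<le> card {0 mod K, 0 mod K + K}" by (rule card_mono[OF _ fibre]) simp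
  also have "\<dots> = 2" using K by simp
  finally consider "card (\<beta> 0) = 0" | "card (\<beta> 0) = 1" | "card (\<beta> 0) = 2" by linarith
  then show False
  proof cases
    case 1
    have "B = {}"
    proof (rule equals0I)
      fix v assume "v \<in> B"
      then have "v \<in> \<beta> v" by (simp add: \<beta>_def)
      then show False using same[of v 0] 1 fin by auto
    qed
    then have "h v = (v + a) mod n" if "v \<in> V" for v using that by (auto simp: B_def T_def)
    moreover have "a dvd n" using a_dvd by (simp add: n_def K_def)
    ultimately have "a dvd h v" if "v \<in> V" "a dvd v" for v
      using that by (simp add: dvd_mod)
    then have "a dvd 1" using invariant[of "\<lambda>v. a dvd v" 1] one by simp
    then show False using ab by auto
  next
    case 2
    have single: "\<exists>y. \<beta> f = {y}" for f using same[of f 0] 2 by (simp add: card_1_singleton_iff)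
    obtain y where y: "\<beta> 0 = {y}" using single by blast
    then have yB: "y \<in> B" "y mod K = 0" by (auto simp: \<beta>_def)
    define L where "L = map (\<lambda>i. (\<rho> ^^ i) y) [0..<k]"
    have pow: "(\<rho> ^^ i) y \<in> \<beta> (int i * \<delta>)" for i
    proof (induction i)
      case 0
      then show ?case using yB by (simp add: \<beta>_def)
    next
      case (Suc i)
      define x where "x = (\<rho> ^^ i) y"
      have x: "x \<in> B" "x mod K = (int i * \<delta>) mod K" using Suc by (auto simp: \<beta>_def x_def)
      have "\<rho> x mod K = (int i * \<delta> + \<delta>) mod K"
        using \<rho>_fibre[OF x(1)] mod_add_cong[OF x(2), of \<delta> \<delta>] by simp
      then show ?case using \<rho>_B[OF x(1)] by (simp add: \<beta>_def x_def[symmetric] algebra_simps)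
    qed
    have L_nth: "L ! i = (\<rho> ^^ i) y" if "i < k" for i using that by (simp add: L_def)
    have lenL: "length L = k" by (simp add: L_def)
    have distL: "distinct L"
      unfolding distinct_conv_nth lenL
    proof (intro allI impI)
      fix i j assume ij: "i < k" "j < k" "i \<noteq> j"
      show "L ! i \<noteq> L ! j"
      proof
        assume "L ! i = L ! j"
        then have "(int i * \<delta>) mod K = (int j * \<delta>) mod K"
          using pow[of i] pow[of j] ij by (auto simp: L_nth \<beta>_def)
        then have "K dvd (int i - int j) * \<delta>" by (simp add: mod_eq_dvd_iff left_diff_distrib)
        then have "K dvd int i - int j" using \<delta> by (auto simp: dvd_diff_commute)
        moreover have "\<bar>int i - int j\<bar> < K" using ij by (simp add: K_def)
        ultimately show False using ij(3) dvd_imp_le_int[of "int i - int j" K] by auto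
      qed
    qed
    have setL: "set L = B"
    proof
      show "set L \<subseteq> B" using pow by (auto simp: L_def \<beta>_def)
      show "B \<subseteq> set L"
      proof
        fix x assume "x \<in> B"
        then have x: "x \<in> \<beta> x" by (simp add: \<beta>_def)
        obtain t where t: "t < k" "(0 + int t * \<delta>) mod K = x mod K" using ex_shift by blast
        then have "(\<rho> ^^ t) y \<in> \<beta> x" using pow[of t] \<beta>_cong[of "int t * \<delta>" x] by simp
        then have "x = (\<rho> ^^ t) y" using single[of x] x by auto
        then show "x \<in> set L" using t(1) by (simp add: L_def)
      qed
    qed
    have "(\<rho> ^^ k) y \<in> \<beta> 0" using pow[of k] \<beta>_cong[of "int k * \<delta>" 0] by (simp add: K_def)
    then have period: "(\<rho> ^^ k) y = y" using y by simp
    have "\<rho> = cycle_of_list L"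
    proof (rule eq_cycle_of_listI[OF distL])
      fix i assume i: "i < length L"
      show "\<rho> (L ! i) = L ! (Suc i mod length L)"
      proof (cases "Suc i = k")
        case True
        then show ?thesis using i lenL period L_nth[of i] L_nth[of 0] k by auto
      next
        case False
        then show ?thesis using i lenL L_nth[of i] L_nth[of "Suc i"] by simp
      qed
    qed (use \<rho>_fix setL in simp)
    moreover have "L \<noteq> []" using lenL k by auto
    ultimately have "sign \<rho> = (- 1) ^ (k - 1)"
      using sign_cycle_of_list[OF distL] lenL by simp
    then show False
      using sign_\<rho> sign_T ab par k by (auto simp: uminus_power_if split: if_splits)
  next
    case 3
    have "B = V"
    proof
      show "V \<subseteq> B"
      proof
        fix v assume "v \<in> V"
        have "card (\<beta> v) = card {v mod K, v mod K + K}" using same[of v 0] 3 K by simp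
        then have "\<beta> v = {v mod K, v mod K + K}" by (intro card_subset_eq fibre) simp_all
        moreover have "v = v mod K \<or> v = v mod K + K"
          using representative[OF \<open>v \<in> V\<close>] .
        ultimately have "v \<in> \<beta> v" by auto
        then show "v \<in> B" by (simp add: \<beta>_def)
      qed
    qed (auto simp: B_def)
    have "b dvd h v" if "v \<in> V" "b dvd v" for v
    proof -
      have "h v = (v + b) mod n \<or> h v = (v + b + K) mod n"
      proof -
        have "v \<in> B" using that(1) \<open>B = V\<close> by simp
        then have "h v \<noteq> (v + a) mod n" using that(1) by (simp add: B_def T_def)
        then show ?thesis using h_arc[OF that(1)] by blast
      qed
      moreover have "b dvd n" "b dvd K" using b_dvd by (simp_all add: n_def K_def)
      ultimately show ?thesis using that(2) by (auto simp: dvd_mod)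
    qed
    then have "b dvd 1" using invariant[of "\<lambda>v. b dvd v" 1] one by simp
    then show False using ab by auto
  qed
qed

section \<open>The characterisation\<close>

theorem theorem1p3:
  fixes n c :: nat
  assumes "n > 0" and "c > 0"
    and "\<not> [c = 0] (mod n)" and "\<not> [c = 2] (mod n)" and "\<not> [c = 3] (mod n)"
  shows "\<not> hamiltonian (with_proj (circ n {2, 3, int c})) \<longleftrightarrow>
    (\<exists>m>0. n = 6 * m \<and> ([c = 3 * m + 2] (mod n) \<or> [c = 3 * m + 3] (mod n)) \<and> even c)"
proof
  assume "\<exists>m>0. n = 6 * m \<and> ([c = 3 * m + 2] (mod n) \<or> [c = 3 * m + 3] (mod n)) \<and> even c"
  then obtain m where m: "m > 0" "n = 6 * m" "[c = 3 * m + 2] (mod n) \<or> [c = 3 * m + 3] (mod n)"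
    and c: "even c" by blast
  have parity: "even x" if "[c = x] (mod n)" for x
  proof -
    have "[c = x] (mod 2)" using that by (rule cong_dvd_mono_modulus) (simp add: m(2))
    then show ?thesis using c cong_dvd_iff by blast
  qed
  have lift: "[int c = int x] (mod 2 * int (3 * m))" if "[c = x] (mod n)" for x
    using that cong_int_iff[of c x n] by (simp add: m(2))
  have "\<not> hamiltonian (with_proj (circ (2 * (3 * m)) {2, 3, int c}))"
    using m(3)
  proof
    assume c_eq: "[c = 3 * m + 2] (mod n)"
    have "int (3 * m + 2) = 2 + int (3 * m)" by simp
    with lift[OF c_eq] have "[int c = 2 + int (3 * m)] (mod 2 * int (3 * m))" by (simp only:)
    then have S: "[s = 3] (mod 2 * int (3 * m)) \<or> [s = 2] (mod 2 * int (3 * m)) \<or>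
        [s = 2 + int (3 * m)] (mod 2 * int (3 * m))" if "s \<in> {2, 3, int c}" for s
      using that cong_refl by blast
    have "2 dvd int (3 * m)" "odd (3 + int (3 * m))"
      using parity[OF c_eq] by simp_all
    then show ?thesis
      using m(1) by (intro not_hamiltonian_half_shift[where a = 3 and b = 2, OF _ _ _ _ _ S]) simp_all
  next
    assume c_eq: "[c = 3 * m + 3] (mod n)"
    have "int (3 * m + 3) = 3 + int (3 * m)" by simp
    with lift[OF c_eq] have "[int c = 3 + int (3 * m)] (mod 2 * int (3 * m))" by (simp only:)
    then have S: "[s = 2] (mod 2 * int (3 * m)) \<or> [s = 3] (mod 2 * int (3 * m)) \<or>
        [s = 3 + int (3 * m)] (mod 2 * int (3 * m))" if "s \<in> {2, 3, int c}" for s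
      using that cong_refl by blast
    have "3 dvd int (3 * m)" "odd (2 + int (3 * m))"
      using parity[OF c_eq] by simp_all
    then show ?thesis
      using m(1) by (intro not_hamiltonian_half_shift[where a = 2 and b = 3, OF _ _ _ _ _ S]) simp_all
  qed
  then show "\<not> hamiltonian (with_proj (circ n {2, 3, int c}))" by (simp add: m(2))
next
  assume nonham: "\<not> hamiltonian (with_proj (circ n {2, 3, int c}))"
  have not_coprime: "\<not> coprime s (int n)" if "s \<in> {2, 3, int c}" for s
    using nonham hamiltonian_of_coprime_jump[OF assms(1) that] by blast
  have "2 dvd int n" "3 dvd int n"
    using prime_imp_coprime[of 2 "int n"] prime_imp_coprime[of 3 "int n"]
      not_coprime[of 2] not_coprime[of 3] by auto
  then have "6 dvd n" by presburger
  then obtain m where m: "n = 6 * m" by (elim dvdE)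
  then have "m > 0" using assms(1) by simp
  define d where "d = (int c - 3) mod int n"
  have d: "0 \<le> d" "d < int n" using assms(1) by (simp_all add: d_def)
  have "[d = int c - 3] (mod int n)" by (simp add: d_def)
  then have dc: "[d + 3 = int c] (mod int n)" using cong_add[of d "int c - 3" "int n" 3 3] by simp
  have c_cong: "[c = x] (mod n)" if "d + 3 = int x \<or> d + 3 = int x + int n" for x
  proof -
    have "[int x = int c] (mod int n)"
      using dc that by (auto simp: cong_def)
    then show ?thesis using cong_int_iff cong_sym by blast
  qed
  have "d \<noteq> 0" using c_cong[of 3] assms(5) by auto
  have "d \<noteq> int n - 1" using c_cong[of 2] assms(4) by auto
  have "d \<noteq> int n - 3" using c_cong[of 0] assms(3) by auto
  have "even (int c) \<longleftrightarrow> even (d + 3)"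
  proof -
    have "[d + 3 = int c] (mod 2)" using dc by (rule cong_dvd_mono_modulus) (simp add: m)
    then show ?thesis using cong_dvd_iff by blast
  qed
  then have parity: "even c \<longleftrightarrow> odd d" by simp
  define e where "e = int n - d"
  have ec: "[3 - e = int c] (mod int (6 * m))"
    using dc by (simp add: e_def m cong_def algebra_simps)
  have one: "even d \<Longrightarrow> 3 dvd d"
    using nonham hamiltonian_one_jump[OF assms(1) \<open>6 dvd n\<close> d _ _ dc] by blast
  have two: "odd d \<Longrightarrow> 3 * int m - 2 < d"
    using nonham hamiltonian_two_jumps[OF \<open>m > 0\<close> d(1) _ _ dc[unfolded m]] unfolding m by force
  have backward: "\<not> (odd e \<and> 5 \<le> e \<and> e < 3 * int m \<or> 6 dvd e \<and> 6 \<le> e \<and> e < 3 * int m)"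
    using nonham hamiltonian_backward_jump[OF _ ec] unfolding m by blast
  have forward: "6 dvd d \<Longrightarrow> 3 * int m < d"
    using nonham hamiltonian_forward_jump[OF _ _ _ dc[unfolded m]] d(1) \<open>d \<noteq> 0\<close> unfolding m by force
  have "odd d"
  proof
    assume "even d"
    with one have "6 dvd d" by presburger
    then have "6 dvd e" by (simp add: e_def m)
    moreover have "0 < e" "e < 3 * int m"
      using forward[OF \<open>6 dvd d\<close>] d(2) by (simp_all add: e_def m)
    moreover have "6 \<le> e" using \<open>6 dvd e\<close> \<open>0 < e\<close> by (rule zdvd_imp_le)
    ultimately show False using backward by blast
  qed
  moreover have "d \<le> 3 * int m"
  proof (rule ccontr)
    assume "\<not> d \<le> 3 * int m"
    then have "e < 3 * int m" by (simp add: e_def m)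
    moreover have "odd e" using \<open>odd d\<close> by (simp add: e_def m)
    moreover have "0 < e" "e \<noteq> 1" "e \<noteq> 3"
      using d(2) \<open>d \<noteq> int n - 1\<close> \<open>d \<noteq> int n - 3\<close> by (simp_all add: e_def)
    then have "5 \<le> e" using \<open>odd e\<close> by presburger
    ultimately show False using backward by blast
  qed
  ultimately have "odd d \<and> (d = 3 * int m - 1 \<or> d = 3 * int m)"
    using two by linarith
  then show "\<exists>m>0. n = 6 * m \<and> ([c = 3 * m + 2] (mod n) \<or> [c = 3 * m + 3] (mod n)) \<and> even c"
    using parity c_cong[of "3 * m + 2"] c_cong[of "3 * m + 3"] m \<open>m > 0\<close>
    by (intro exI[of _ m]) auto
qed

end
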